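(* Let $U$ be an open set with $U\subseteq\mathbb D$ (the open unit disk). Then the equilibrium measure for $U^c$ under logarithmic potential with quadratic external field (i.e. the unique minimizer of $R_\mu$ over $\mu\in\mathcal P(U^c)$) is $\nu=\nu_1+\nu_2$, where $d\nu_1(z)=\frac1\pi\,dm(z)$ for $z\in\overline{\mathbb D}\setminus U$ and $\nu_1$ vanishes elsewhere, and $\nu_2$ is the balayage measure on $\partial U$. Moreover $$R_U=\frac34+\frac12\left[\int_{\partial U}|z|^2\,d\nu_2(z)-\frac1\pi\int_U|z|^2\,dm(z)\right].$$
   Context: $m$ is Lebesgue measure on $\mathbb C$. For $E\subseteq\mathbb C$, $\mathcal P(E)$ is the set of compactly supported Borel probability measures with support in $E$; $U^c=\mathbb C\setminus U$. For such $\mu$, $I_\mu=\iint\log\frac1{|z-w|}d\mu(z)d\mu(w)$ and $R_\mu=I_\mu+\int|z|^2d\mu(z)$; $R_U:=\inf_{\mu\in\mathcal P(U^c)}R_\mu$. A Borel set $B$ is polar if $I_\mu=+\infty$ for every compactly supported probability measure $\mu$ with support in $B$; a property holds quasi-everywhere (q.e.) on a set if it holds there except on a Borel polar set. For a bounded open set $U$, the balayage measure on $\partial U$ is the unique positive Borel measure $\nu_2$ on $\partial U$ such that $\nu_2(B)=0$ for every Borel polar set $B$ and $\int_{\partial U}\log\frac1{|z-w|}d\nu_2(w)=\frac1\pi\int_U\log\frac1{|z-w|}dm(w)$ for q.e. $z\in\mathbb C\setminus U$. *)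

theory Defs
  imports "HOL-Probability.Probability"
begin

definition msupp :: "complex measure \<Rightarrow> complex set" where
  "msupp \<mu> = {z. \<forall>e>0. emeasure \<mu> (ball z e) \<noteq> 0}"

definition prob_on :: "complex set \<Rightarrow> complex measure \<Rightarrow> bool" where
  "prob_on E \<mu> \<longleftrightarrow> sets \<mu> = sets borel \<and> prob_space \<mu> \<and>
     compact (msupp \<mu>) \<and> msupp \<mu> \<subseteq> E"

definition lkpos :: "complex \<Rightarrow> complex \<Rightarrow> ennreal" where
  "lkpos z w = (if z = w then \<infinity> else ennreal (max 0 (- ln (cmod (z - w)))))"

definition lkneg :: "complex \<Rightarrow> complex \<Rightarrow> ennreal" where
  "lkneg z w = ennreal (max 0 (ln (cmod (z - w))))"

definition log_pot :: "complex measure \<Rightarrow> complex \<Rightarrow> ereal" where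
  "log_pot \<mu> z = enn2ereal (\<integral>\<^sup>+ w. lkpos z w \<partial>\<mu>) - enn2ereal (\<integral>\<^sup>+ w. lkneg z w \<partial>\<mu>)"

definition log_energy :: "complex measure \<Rightarrow> ereal" where
  "log_energy \<mu> = enn2ereal (\<integral>\<^sup>+ z. (\<integral>\<^sup>+ w. lkpos z w \<partial>\<mu>) \<partial>\<mu>)
                 - enn2ereal (\<integral>\<^sup>+ z. (\<integral>\<^sup>+ w. lkneg z w \<partial>\<mu>) \<partial>\<mu>)"

definition R_meas :: "complex measure \<Rightarrow> ereal" where
  "R_meas \<mu> = log_energy \<mu> + ereal (\<integral> z. (cmod z)\<^sup>2 \<partial>\<mu>)"

definition R_set :: "complex set \<Rightarrow> ereal" where
  "R_set U = (INF \<mu> \<in> {\<mu>. prob_on (- U) \<mu>}. R_meas \<mu>)"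

definition polar :: "complex set \<Rightarrow> bool" where
  "polar B \<longleftrightarrow> B \<in> sets borel \<and> (\<forall>\<mu>. prob_on B \<mu> \<longrightarrow> log_energy \<mu> = \<infinity>)"

definition qe_on :: "complex set \<Rightarrow> (complex \<Rightarrow> bool) \<Rightarrow> bool" where
  "qe_on S P \<longleftrightarrow> (\<exists>B. polar B \<and> (\<forall>z \<in> S - B. P z))"

definition area_meas :: "complex set \<Rightarrow> complex measure" where
  "area_meas A = density lborel (\<lambda>w. ennreal (1 / pi) * indicator A w)"

definition is_balayage :: "complex set \<Rightarrow> complex measure \<Rightarrow> bool" where
  "is_balayage U \<nu> \<longleftrightarrow> sets \<nu> = sets borel \<and> finite_measure \<nu> \<and>
     emeasure \<nu> (- frontier U) = 0 \<and>
     (\<forall>B. polar B \<longrightarrow> emeasure \<nu> B = 0) \<and>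
     qe_on (- U) (\<lambda>z. log_pot \<nu> z = log_pot (area_meas U) z)"

definition add_meas :: "complex measure \<Rightarrow> complex measure \<Rightarrow> complex measure" where
  "add_meas \<mu> \<nu> = measure_of UNIV (sets borel) (\<lambda>A. emeasure \<mu> A + emeasure \<nu> A)"

end

theory Submission
  imports Defs "HOL-Complex_Analysis.Complex_Analysis" "HOL-Real_Asymp.Real_Asymp"
begin

text \<open>
  The potential of the normalised area measure of the unit disk is \<open>(1 - |z|\<^sup>2)/2\<close> inside the disk and
  \<open>-log |z|\<close> outside, so \<open>2 U\<^sup>\<nu> + |z|\<^sup>2\<close> equals 1 quasi-everywhere on the support of
  \<open>\<nu> = \<nu>1 + \<nu>2\<close> (balayage does not change the potential off \<open>U\<close>) and is at least 1 elsewhere off \<open>U\<close>.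
  A measure of finite energy does not charge polar sets, hence \<open>R \<mu> - R \<nu>\<close> is at least the logarithmic
  energy of the neutral measure \<open>\<mu> - \<nu>\<close>.  That energy is nonnegative, and zero only for \<open>\<mu> = \<nu>\<close>,
  because by Frullani's integral the logarithmic kernel is, up to a constant, a superposition of Gaussians
  \<open>exp (-t |z - w|\<^sup>2)\<close>, each of which is a convolution square.
\<close>

section \<open>Area measure and the potential of the disk\<close>

text \<open>Energies may be infinite, so the energy of mu - nu cannot be formed by subtraction.
  Positivity is instead an additive identity between nonnegative integrals, E(mu,mu) + E(nu,nu) = 2
  E(mu,nu) + D, where D is an integral of squares: D >= 0 gives minimality, D = 0 gives uniqueness.
  The logarithm changes sign, so it is replaced by log (2L / |z - w|), nonnegative on the disk of
  radius L.

  This shift is harmless only between measures of equal mass. The definition of balayage does not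
  mention the mass of nu2; it is read off from the growth of the potentials at infinity, where q.e.
  equality still supplies points because polar sets have area zero. Finite energy of nu needs no
  separate argument: nu2 charges no polar set, so the bounded potential formula can be integrated
  against nu itself.

  The constant 3/4 is 1/2 + 1/4: integrating the potential formula gives R nu = (1 + m) / 2 with m
  the second moment of nu, and m is 1/2, the second moment of the normalised disk, plus the bracket
  in the theorem.\<close>

lemma emeasure_lborel_le_isometry_image:
  fixes f :: "'a::euclidean_space \<Rightarrow> 'a"
  assumes iso: "\<And>x y. dist (f x) (f y) = dist x y" and "surj f" and "open S" and "open (f ` S)"
  shows "emeasure lborel S \<le> emeasure lborel (f ` S)"
proof -
  let ?B = "\<lambda>p. ball (fst p) (snd p)"
  have inj: "inj f" by (metis dist_eq_0_iff injI iso)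
  have im: "f ` ball a r = ball (f a) r" for a r
  proof
    show "ball (f a) r \<subseteq> f ` ball a r"
    proof
      fix y assume y: "y \<in> ball (f a) r"
      obtain x where "y = f x" using \<open>surj f\<close> by blast
      with y show "y \<in> f ` ball a r" by (auto simp: iso)
    qed
    show "f ` ball a r \<subseteq> ball (f a) r" by (auto simp: iso)
  qed
  \<comment> \<open>Vitali: disjoint balls inside S fill S up to a null set. An isometry sends each
    to a ball of the same radius, hence of the same measure, so the images already fit the whole
    measure of S into the image of S.\<close>
  define K where "K = {p. 0 < snd p \<and> ?B p \<subseteq> S}"
  have "\<exists>i. i \<in> K \<and> x \<in> ?B i \<and> snd i < d" if "x \<in> S" "0 < d" for x d
  proof -
    obtain e where "e > 0" "ball x e \<subseteq> S" using \<open>open S\<close> \<open>x \<in> S\<close> by (meson openE)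
    then have "(x, min e (d/2)) \<in> K \<and> x \<in> ?B (x, min e (d/2)) \<and> snd (x, min e (d/2)) < d"
      using \<open>0 < d\<close> by (auto simp: K_def subset_iff)
    then show ?thesis by blast
  qed
  from Vitali_covering_theorem_balls[where a=fst and r=snd, OF this]
  obtain C where C: "countable C" "C \<subseteq> K"
     "pairwise (\<lambda>i j. disjnt (?B i) (?B j)) C" "negligible (S - (\<Union>i \<in> C. ?B i))" .
  have bor: "(\<Union>i \<in> C. ?B i) \<in> sets borel" "S \<in> sets borel"
    using \<open>open S\<close> by (auto intro!: borel_open)
  then have null: "S - (\<Union>i \<in> C. ?B i) \<in> null_sets lborel"
    using C(4) bor negligible_iff_null_sets null_sets_completion_iff[of _ lborel] by (metis sets.Diff sets_lborel)
  have S: "S = (\<Union>i \<in> C. ?B i) \<union> (S - (\<Union>i \<in> C. ?B i))" using C(2) by (auto simp: K_def)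
  have "emeasure lborel S = emeasure lborel (\<Union>i \<in> C. ?B i)"
    by (subst S, rule emeasure_Un_null_set) (use null bor in auto)
  also have "\<dots> = (\<integral>\<^sup>+i. emeasure lborel (?B i) \<partial>count_space C)"
    using C by (intro emeasure_UN_countable) (auto simp: disjoint_family_on_def pairwise_def disjnt_def)
  also have "\<dots> = (\<integral>\<^sup>+i. emeasure lborel (f ` ?B i) \<partial>count_space C)"
    using C(2) by (intro nn_integral_cong) (auto simp: im K_def emeasure_ball)
  also have "\<dots> = emeasure lborel (\<Union>i \<in> C. f ` ?B i)"
  proof (rule emeasure_UN_countable[symmetric])
    show "disjoint_family_on (\<lambda>i. f ` ?B i) C"
      using C(3) inj by (auto simp: disjoint_family_on_def pairwise_def disjnt_def image_Int[symmetric] simp del: mem_ball)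
  qed (use C(1) in \<open>auto simp: im\<close>)
  also have "\<dots> \<le> emeasure lborel (f ` S)"
    using C(2) \<open>open (f ` S)\<close> by (intro emeasure_mono) (auto simp: K_def)
  finally show ?thesis .
qed

text \<open>Open boxes determine \<open>lborel\<close>, and on them the one-sided bound, used for
  \<open>f\<close> and for its inverse \<open>g\<close>, becomes an equality. The case of interest
  is rotation of the plane.\<close>

lemma lborel_distr_isometry:
  fixes f :: "'a::euclidean_space \<Rightarrow> 'a"
  assumes iso: "\<And>x y. dist (f x) (f y) = dist x y" and "surj f"
  shows "distr lborel borel f = lborel"
proof (rule lborel_eqI[symmetric])
  have inj: "inj f" by (metis dist_eq_0_iff injI iso)
  define g where "g = inv f"
  have fg: "f (g x) = x" "g (f x) = x" for x
    using \<open>surj f\<close> inj by (simp_all add: g_def surj_f_inv_f)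
  have giso: "dist (g x) (g y) = dist x y" for x y using iso[of "g x" "g y"] fg by simp
  have "surj g" using fg by (metis surj_def)
  have cont: "continuous_on UNIV f" "continuous_on UNIV g"
    using iso giso by (auto simp: continuous_on_iff)
  fix l u :: 'a
  assume le: "\<And>b. b \<in> Basis \<Longrightarrow> l \<bullet> b \<le> u \<bullet> b"
  have eq: "f -` box l u = g ` box l u" using fg by (auto simp: image_iff) metis
  have op: "open (g ` box l u)" unfolding eq[symmetric] using cont by (intro open_vimage open_box)
  have "emeasure (distr lborel borel f) (box l u) = emeasure lborel (g ` box l u)"
    using cont by (subst emeasure_distr) (auto simp: eq intro: borel_measurable_continuous_onI)
  also have "\<dots> = emeasure lborel (box l u)"
  proof (rule antisym)
    show "emeasure lborel (g ` box l u) \<le> emeasure lborel (box l u)"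
      using emeasure_lborel_le_isometry_image[OF iso \<open>surj f\<close> op, unfolded image_image fg image_ident]
        open_box by blast
    show "emeasure lborel (box l u) \<le> emeasure lborel (g ` box l u)"
      using emeasure_lborel_le_isometry_image[OF giso \<open>surj g\<close> _ op] open_box by blast
  qed
  finally show "emeasure (distr lborel borel f) (box l u) = (\<Prod>b\<in>Basis. (u - l) \<bullet> b)"
    using le by simp
qed simp

text \<open>Stands in for polar coordinates: area is invariant under each rotation, so averaging
  over t changes nothing. The inner integral is the mean of \<open>F\<close> over the circle through
  \<open>w\<close>.\<close>

lemma nn_integral_lborel_rotation_average:
  fixes F :: "complex \<Rightarrow> ennreal"
  assumes [measurable]: "F \<in> borel_measurable borel"
  shows "(\<integral>\<^sup>+w. F w \<partial>lborel) =
    (\<integral>\<^sup>+w. (\<integral>\<^sup>+t. F (w * cis (2 * pi * t)) * indicator {0..1} t \<partial>lborel) \<partial>lborel)"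
proof -
  have [measurable]: "cis \<in> borel_measurable borel"
    by (intro borel_measurable_continuous_onI continuous_intros)
  have rot: "(\<integral>\<^sup>+w. F (w * cis (2 * pi * t)) \<partial>lborel) = (\<integral>\<^sup>+w. F w \<partial>lborel)" for t
  proof -
    have d: "distr lborel borel (\<lambda>w::complex. w * cis (2 * pi * t)) = lborel"
    proof (rule lborel_distr_isometry)
      show "surj (\<lambda>w. w * cis (2 * pi * t))"
        by (rule surjI[of _ "\<lambda>w. w / cis (2 * pi * t)"]) simp
    qed (simp add: dist_norm norm_mult flip: left_diff_distrib)
    show ?thesis by (subst (2) d[symmetric], subst nn_integral_distr) auto
  qed
  have "(\<integral>\<^sup>+w. (\<integral>\<^sup>+t. F (w * cis (2 * pi * t)) * indicator {0..1} t \<partial>lborel) \<partial>lborel)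
      = (\<integral>\<^sup>+t. (\<integral>\<^sup>+w. F (w * cis (2 * pi * t)) * indicator {0..1} t \<partial>lborel) \<partial>lborel)"
    by (rule lborel_pair.Fubini') measurable
  also have "\<dots> = (\<integral>\<^sup>+t. (\<integral>\<^sup>+w. F w \<partial>lborel) * indicator {0..1::real} t \<partial>lborel)"
    by (simp add: nn_integral_multc rot)
  also have "\<dots> = (\<integral>\<^sup>+w. F w \<partial>lborel)"
    by (simp add: nn_integral_cmult)
  finally show ?thesis by simp
qed

section \<open>Radial integrals against area\<close>

lemma emeasure_lborel_cball_complex: "r \<ge> 0 \<Longrightarrow> emeasure lborel (cball (z::complex) r) = ennreal (pi * r\<^sup>2)"
  using emeasure_cball[of r z] unit_ball_vol_2 by simp

text \<open>The disk where |w|^2 <= a has area pi a, so |w|^2 pushes area forward to pi times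
  Lebesgue measure on the half line. Using the squared modulus as variable leaves a constant
  density.\<close>

lemma nn_integral_lborel_radial:
  fixes h :: "real \<Rightarrow> ennreal"
  assumes [measurable]: "h \<in> borel_measurable borel"
  shows "(\<integral>\<^sup>+w. h ((cmod w)\<^sup>2) \<partial>lborel) = ennreal pi * (\<integral>\<^sup>+v. h v * indicator {0..} v \<partial>lborel)"
proof -
  let ?D = "density lborel (\<lambda>v::real. ennreal pi * indicator {0..} v)"
  let ?E = "range atMost :: real set set"
  have em: "emeasure (distr lborel borel (\<lambda>w. (cmod w)\<^sup>2)) {..a} = ennreal (pi * max 0 a)" for a
  proof -
    have "(\<lambda>w. (cmod w)\<^sup>2) -` {..a} = (if a < 0 then {} else cball 0 (sqrt a))"
      by (auto simp: real_le_rsqrt sqrt_le_D dist_norm) (smt (verit) zero_le_power2, smt (verit) real_sqrt_le_iff real_sqrt_abs norm_ge_zero)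
    then show ?thesis
      by (subst emeasure_distr) (auto simp: emeasure_lborel_cball_complex)
  qed
  have "distr lborel borel (\<lambda>w. (cmod w)\<^sup>2) = ?D"
  proof (rule measure_eqI_generator_eq[where E = ?E and \<Omega> = UNIV and A = "\<lambda>i. {..real i}"])
    show "Int_stable ?E" by (auto simp: Int_stable_def)
    show "sets (distr lborel borel (\<lambda>w. (cmod w)\<^sup>2)) = sigma_sets UNIV ?E" "sets ?D = sigma_sets UNIV ?E"
      by (simp_all add: borel_eq_atMost[where 'a=real])
    show "(\<Union>i. {..real i}) = UNIV" by (auto simp: real_arch_simple)
    fix X assume "X \<in> ?E"
    then obtain a where X: "X = {..a}" by auto
    have "emeasure ?D {..a} = ennreal pi * emeasure lborel ({..a} \<inter> {0..})"
      by (subst emeasure_density) (auto simp: nn_integral_cmult mult.assoc indicator_inter_arith[symmetric] Int_commute)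
    also have "{..a} \<inter> {0..} = {0..a}" by auto
    finally show "emeasure (distr lborel borel (\<lambda>w. (cmod w)\<^sup>2)) X = emeasure ?D X"
      unfolding X em by (cases "a < 0") (auto simp: max_def ennreal_mult)
  qed (auto simp: em)
  then have "(\<integral>\<^sup>+v. h v \<partial>distr lborel borel (\<lambda>w. (cmod w)\<^sup>2)) = (\<integral>\<^sup>+v. h v \<partial>?D)" by simp
  then show ?thesis
    by (simp add: nn_integral_distr nn_integral_density nn_integral_cmult mult_ac)
qed

lemma nn_integral_lborel_gaussian:
  assumes "s > 0"
  shows "(\<integral>\<^sup>+w. ennreal (exp (- s * (cmod (z - w))\<^sup>2)) \<partial>lborel) = ennreal (pi / s)"
proof -
  have "(\<integral>\<^sup>+w. ennreal (exp (- s * (cmod (z - w))\<^sup>2)) \<partial>lborel) =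
        (\<integral>\<^sup>+w. ennreal (exp (- s * (cmod (z - w))\<^sup>2)) \<partial>distr lborel borel ((+) z))"
    by (simp add: lborel_distr_plus)
  also have "\<dots> = (\<integral>\<^sup>+w. ennreal (exp (- s * (cmod w)\<^sup>2)) \<partial>lborel)"
    by (subst nn_integral_distr) auto
  also have "\<dots> = ennreal pi * (\<integral>\<^sup>+v. ennreal (exp (- s * v)) * indicator {0..} v \<partial>lborel)"
    by (rule nn_integral_lborel_radial) auto
  also have "(\<integral>\<^sup>+v. ennreal (exp (- s * v)) * indicator {0..} v \<partial>lborel) = ennreal (0 - (- exp (- s * 0) / s))"
  proof (rule nn_integral_FTC_atLeast)
    show "((\<lambda>v. - exp (- s * v) / s) \<longlongrightarrow> 0) at_top" using assms by real_asymp
  qed (use assms in \<open>auto intro!: derivative_eq_intros\<close>)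
  finally show ?thesis using assms by (simp flip: ennreal_mult)
qed

text \<open>Mean value property of log |1 - u w / z| on the unit circle: since |w| < |z|, the
  argument stays in the right half plane for |u| <= 1, so its \<open>Ln\<close> is holomorphic there
  and vanishes at u = 0, and Cauchy's formula gives mean 0.\<close>

lemma has_integral_ln_cmod_circle:
  assumes "cmod w < cmod z"
  shows "((\<lambda>t. ln (cmod (z - w * cis (2 * pi * t)))) has_integral ln (cmod z)) {0..1}"
proof -
  have z: "z \<noteq> 0" using assms by auto
  let ?f = "\<lambda>u. Ln (1 - u * w / z)"
  have pos: "Re (1 - u * w / z) > 0" if "cmod u \<le> 1" for u
  proof -
    have "cmod (u * w / z) \<le> 1 * cmod w / cmod z"
      using that z by (simp add: norm_mult norm_divide divide_right_mono mult_left_le_one_le)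
    also have "\<dots> < 1" using assms z by simp
    finally show ?thesis using complex_Re_le_cmod[of "u * w / z"] by simp
  qed
  have "1 - u * w / z \<notin> \<real>\<^sub>\<le>\<^sub>0" if "cmod u \<le> 1" for u
    using pos[OF that] by (simp add: complex_nonpos_Reals_iff)
  then have "?f holomorphic_on cball 0 1"
    by (intro holomorphic_intros) (auto simp: z)
  then have "((\<lambda>u. ?f u / (u - 0)) has_contour_integral (2 * of_real pi * \<i> * ?f 0)) (circlepath 0 1)"
    by (rule Cauchy_integral_circlepath_simple) simp
  then have "((\<lambda>t. ?f (cis (2 * pi * t)) * (2 * pi * \<i>)) has_integral 0) {0..1}"
    unfolding has_contour_integral diff_0_right mult_zero_left div_0 Ln_1 mult_zero_right
    by (rule has_integral_eq[rotated])
      (subst vector_derivative_circlepath, simp add: circlepath cis_conv_exp mult_ac)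
  then have "((\<lambda>t. ?f (cis (2 * pi * t)) * (2 * pi * \<i>) / (2 * pi * \<i>)) has_integral 0 / (2 * pi * \<i>)) {0..1}"
    by (rule has_integral_divide)
  then have "((\<lambda>t. Re (?f (cis (2 * pi * t)))) has_integral 0) {0..1}"
    using has_integral_Re[of "\<lambda>t. ?f (cis (2 * pi * t))" 0 "{0..1}"] by simp
  then have "((\<lambda>t. Re (?f (cis (2 * pi * t))) + ln (cmod z)) has_integral 0 + ln (cmod z)) {0..1}"
    using has_integral_const_real[of "ln (cmod z)" 0 1] by (intro has_integral_add) auto
  moreover have "Re (?f (cis (2 * pi * t))) + ln (cmod z) = ln (cmod (z - w * cis (2 * pi * t)))" for t
  proof -
    have nz: "1 - cis (2 * pi * t) * w / z \<noteq> 0" using pos[of "cis (2 * pi * t)"] by auto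
    have "z - w * cis (2 * pi * t) = z * (1 - cis (2 * pi * t) * w / z)"
      using z by (simp add: field_simps)
    then have "cmod (z - w * cis (2 * pi * t)) = cmod z * cmod (1 - cis (2 * pi * t) * w / z)"
      by (simp only: norm_mult)
    then show ?thesis using nz z by (simp add: ln_mult)
  qed
  ultimately show ?thesis by simp
qed

text \<open>Newton's theorem in the plane: the mean over a circle sees only the larger modulus. The
  bound on \<open>M\<close> makes the integrand nonnegative, so that the gauge integral can be read
  as a nonnegative Lebesgue integral.\<close>

lemma nn_integral_ln_cmod_circle:
  assumes ne: "cmod w \<noteq> cmod z" and M: "cmod z + cmod w \<le> M"
  shows "(\<integral>\<^sup>+t. ennreal (ln (M / cmod (z - w * cis (2 * pi * t)))) * indicator {0..1} t \<partial>lborel)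
    = ennreal (ln (M / max (cmod z) (cmod w)))"
proof (rule nn_integral_has_integral_lebesgue')
  let ?d = "\<lambda>t. cmod (z - w * cis (2 * pi * t))"
  have d: "0 < ?d t" "?d t \<le> M" for t
  proof -
    have "cmod z \<noteq> cmod (w * cis (2 * pi * t))" using ne by (simp add: norm_mult)
    then show "0 < ?d t" by auto
    show "?d t \<le> M" using norm_triangle_ineq4[of z "w * cis (2 * pi * t)"] M by (simp add: norm_mult)
  qed
  have Mpos: "M > 0" using d[of 0] by linarith
  show "0 \<le> ln (M / ?d t)" for t
    using d[of t] by (intro ln_ge_zero) simp
  have "((\<lambda>t. ln (?d t)) has_integral ln (max (cmod z) (cmod w))) {0..1}"
  proof (cases "cmod w < cmod z")
    case True
    then show ?thesis using has_integral_ln_cmod_circle[of w z] by (simp add: max_def)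
  next
    case False
    \<comment> \<open>Conjugating and multiplying by the unimodular \<open>cis\<close> exchanges the
      roles of z and w, which reduces |w| > |z| to the previous case.\<close>
    have sym: "?d t = cmod (cnj w - cnj z * cis (2 * pi * t))" for t
    proof -
      have "cmod (cnj w - cnj z * cis (2 * pi * t)) = cmod (cnj (cnj w - cnj z * cis (2 * pi * t)) * cis (2 * pi * t))"
        by (simp only: norm_mult complex_mod_cnj norm_cis mult_1_right)
      also have "cnj (cnj w - cnj z * cis (2 * pi * t)) * cis (2 * pi * t) = - (z - w * cis (2 * pi * t))"
        by (simp add: left_diff_distrib mult.assoc cis_cnj cis_mult)
      finally show ?thesis by (simp only: norm_minus_cancel)
    qed
    show ?thesis using has_integral_ln_cmod_circle[of "cnj z" "cnj w"] False ne
      unfolding sym by (simp add: max_def)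
  qed
  then have "((\<lambda>t. ln M - ln (?d t)) has_integral ln M - ln (max (cmod z) (cmod w))) {0..1}"
    using has_integral_const_real[of "ln M" 0 1] by (intro has_integral_diff) auto
  moreover have "ln M - ln (?d t) = ln (M / ?d t)" for t
    using d[of t] Mpos by (simp add: ln_div)
  moreover have "ln M - ln (max (cmod z) (cmod w)) = ln (M / max (cmod z) (cmod w))"
    using d[of 0] Mpos ne by (subst ln_div) (auto simp: max_def)
  ultimately show "((\<lambda>t. ln (M / ?d t)) has_integral ln (M / max (cmod z) (cmod w))) {0..1}" by simp
qed

text \<open>With v = |w|^2 this is the radial average left over after the circle means. For a <= 1
  the integrand is constant up to v = a^2; beyond that point \<open>?F\<close> is an
  antiderivative.\<close>

lemma has_integral_ln_max_sqrt:
  assumes "0 \<le> a" "0 < M"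
  shows "((\<lambda>v. ln (M / max a (sqrt v))) has_integral
    (if a \<le> 1 then ln M + (1 - a\<^sup>2) / 2 else ln (M / a))) {0..1}"
proof (cases "a \<le> 1")
  case False
  have "((\<lambda>v::real. ln (M / a)) has_integral ln (M / a)) {0..1}"
    using has_integral_const_real[of "ln (M / a)" 0 1] by simp
  then have "((\<lambda>v. ln (M / max a (sqrt v))) has_integral ln (M / a)) {0..1}"
  proof (rule has_integral_eq[rotated])
    fix v :: real assume "v \<in> {0..1}"
    then have "sqrt v \<le> 1" by simp
    then have "sqrt v < a" using False by linarith
    then show "ln (M / a) = ln (M / max a (sqrt v))" by (simp add: max_def)
  qed
  then show ?thesis using False by simp
next
  case True
  let ?f = "\<lambda>v. ln (M / max a (sqrt v))" and ?F = "\<lambda>v. v * ln M - (v * ln v - v) / 2"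
  have a2: "a\<^sup>2 \<le> 1" using True assms by (simp add: power_le_one)
  have "((\<lambda>v::real. ln (M / a)) has_integral a\<^sup>2 * ln (M / a)) {0..a\<^sup>2}"
    using has_integral_const_real[of "ln (M / a)" 0 "a\<^sup>2"] by simp
  then have 1: "(?f has_integral a\<^sup>2 * ln (M / a)) {0..a\<^sup>2}"
  proof (rule has_integral_eq[rotated])
    fix v assume "v \<in> {0..a\<^sup>2}"
    then have "sqrt v \<le> a" using assms by (auto intro: real_le_lsqrt)
    then show "ln (M / a) = ln (M / max a (sqrt v))" by (simp add: max_def)
  qed
  \<comment> \<open>Only a = 0 is delicate: there \<open>v * ln v\<close> takes the value 0 at v =
    0, which is its limit from the right.\<close>
  have cont: "continuous_on {a\<^sup>2..1} (\<lambda>v::real. v * ln v)"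
  proof (cases "a = 0")
    case False
    then show ?thesis using assms by (intro continuous_intros) auto
  next
    case True
    have "((\<lambda>v::real. v * ln v) \<longlongrightarrow> 0) (at_right 0)" by real_asymp
    then have "continuous (at x within {0..1}) (\<lambda>v::real. v * ln v)" if "x \<in> {0..1}" for x
    proof (cases "x = 0")
      case True
      then show ?thesis using \<open>((\<lambda>v::real. v * ln v) \<longlongrightarrow> 0) (at_right 0)\<close>
        by (simp add: continuous_within at_within_Icc_at_right)
    next
      case False
      with that show ?thesis by (intro continuous_intros) auto
    qed
    then show ?thesis using True by (simp add: continuous_on_eq_continuous_within)
  qed
  have "(?f has_integral ?F 1 - ?F (a\<^sup>2)) {a\<^sup>2..1}"
  proof (rule fundamental_theorem_of_calculus_interior[OF a2])
    show "continuous_on {a\<^sup>2..1} ?F" by (intro continuous_intros cont) auto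
    fix x assume x: "x \<in> {a\<^sup>2<..<1}"
    then have "x > 0" "a < sqrt x" using assms by (auto simp: real_less_rsqrt intro: le_less_trans[OF zero_le_power2])
    then have f: "?f x = ln M - ln x / 2" using assms by (simp add: max_def ln_div ln_sqrt)
    have "(?F has_real_derivative ln M - ln x / 2) (at x)"
      using \<open>x > 0\<close> by (auto intro!: derivative_eq_intros simp: field_simps)
    then show "(?F has_vector_derivative ?f x) (at x)"
      by (simp add: f has_real_derivative_iff_has_vector_derivative)
  qed
  from has_integral_combine[OF _ a2 1 this]
  have "(?f has_integral a\<^sup>2 * ln (M / a) + (?F 1 - ?F (a\<^sup>2))) {0..1}" by simp
  moreover have "a\<^sup>2 * ln (M / a) + (?F 1 - ?F (a\<^sup>2)) = ln M + (1 - a\<^sup>2) / 2"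
    using assms by (cases "a = 0") (auto simp: ln_div ln_realpow field_simps)
  ultimately show ?thesis using True by (simp only: if_True)
qed

text \<open>
  With \<open>M = 2 L\<close> the shifted kernel is nonnegative on the disk of radius \<open>L\<close>, so that energies and
  potentials of measures living there can be handled as \<open>ennreal\<close> integrals.
\<close>
definition lker :: "real \<Rightarrow> complex \<Rightarrow> complex \<Rightarrow> ennreal" where
  "lker M z w = (if z = w then \<infinity> else ennreal (ln (M / cmod (z - w))))"

lemma lker_measurable[measurable (raw)]:
  assumes [measurable]: "f \<in> borel_measurable N" "g \<in> borel_measurable N"
  shows "(\<lambda>x. lker M (f x) (g x)) \<in> borel_measurable N"
  unfolding lker_def by measurable

text \<open>Circle means turn the kernel into log (M / max |z| |w|), up to the null circle |w| =
  |z|, and the radial formula integrates this over v <= 1. The measure is plain area, whence the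
  factor pi.\<close>

lemma disc_potential:
  assumes M: "cmod z + 1 \<le> M"
  shows "(\<integral>\<^sup>+w. lker M z w * indicator (cball 0 1) w \<partial>lborel) =
    ennreal (pi * (if cmod z \<le> 1 then ln M + (1 - (cmod z)\<^sup>2) / 2 else ln (M / cmod z)))" (is "_ = ennreal (pi * ?R)")
proof -
  let ?a = "cmod z"
  have M0: "M > 0" using M norm_ge_zero[of z] by linarith
  have [measurable]: "cball (0::complex) 1 \<in> sets borel" by simp
  have "AE w::complex in lborel. w \<notin> sphere 0 ?a"
  proof (rule AE_not_in)
    have "sphere (0::complex) ?a \<in> null_sets lebesgue" using negligible_sphere negligible_iff_null_sets by blast
    then show "sphere (0::complex) ?a \<in> null_sets lborel"
      using null_sets_completion_iff[of "sphere (0::complex) ?a" lborel] by simp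
  qed
  then have "AE w in lborel. (\<integral>\<^sup>+t. lker M z (w * cis (2 * pi * t)) * indicator (cball 0 1) (w * cis (2 * pi * t))
        * indicator {0..1} t \<partial>lborel) = ennreal (ln (M / max ?a (sqrt ((cmod w)\<^sup>2)))) * indicator {..1} ((cmod w)\<^sup>2)"
  proof eventually_elim
    case (elim w)
    then have ne: "cmod w \<noteq> ?a" by auto
    show ?case
    proof (cases "cmod w \<le> 1")
      case True
      have "z \<noteq> w * cis (2 * pi * t)" for t using ne by (auto simp: norm_mult)
      then show ?thesis using nn_integral_ln_cmod_circle[OF ne, of M] True M
        by (simp add: lker_def norm_mult power_le_one)
    qed (simp add: norm_mult power2_le_iff_abs_le abs_square_le_1)
  qed
  moreover have "(\<lambda>w. lker M z w * indicator (cball 0 1) w) \<in> borel_measurable borel" by measurable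
  ultimately have "(\<integral>\<^sup>+w. lker M z w * indicator (cball 0 1) w \<partial>lborel) =
      (\<integral>\<^sup>+w. ennreal (ln (M / max ?a (sqrt ((cmod w)\<^sup>2)))) * indicator {..1} ((cmod w)\<^sup>2) \<partial>lborel)"
    by (subst nn_integral_lborel_rotation_average) (auto intro!: nn_integral_cong_AE)
  also have "\<dots> = ennreal pi * (\<integral>\<^sup>+v. ennreal (ln (M / max ?a (sqrt v))) * indicator {..1} v * indicator {0..} v \<partial>lborel)"
    by (rule nn_integral_lborel_radial) auto
  also have "(\<integral>\<^sup>+v. ennreal (ln (M / max ?a (sqrt v))) * indicator {..1} v * indicator {0..} v \<partial>lborel) =
      (\<integral>\<^sup>+v. ennreal (ln (M / max ?a (sqrt v))) * indicator {0..1} v \<partial>lborel)"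
    by (intro nn_integral_cong) (auto split: split_indicator)
  also have "\<dots> = ennreal ?R"
  proof (rule nn_integral_has_integral_lebesgue'[OF _ has_integral_ln_max_sqrt])
    fix v :: real assume v: "v \<in> {0..1}"
    then have "sqrt v \<le> 1" by simp
    then have "max ?a (sqrt v) \<le> M" using M norm_ge_zero[of z] by linarith
    then show "0 \<le> ln (M / max ?a (sqrt v))"
      using v by (cases "max ?a (sqrt v) = 0") (auto simp: max_def intro!: ln_ge_zero)
  qed (use M0 in auto)
  also have "ennreal pi * ennreal ?R = ennreal (pi * ?R)"
    by (simp add: ennreal_mult')
  finally show ?thesis .
qed

lemma nn_integral_cmod_sq_disc:
  "(\<integral>\<^sup>+w. ennreal ((cmod w)\<^sup>2) * indicator (cball 0 1) w \<partial>lborel) = ennreal (pi / 2)"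
proof -
  have "(\<integral>\<^sup>+w. ennreal ((cmod w)\<^sup>2) * indicator (cball 0 1) w \<partial>lborel) =
        (\<integral>\<^sup>+w. ennreal ((cmod w)\<^sup>2) * indicator {..1} ((cmod w)\<^sup>2) \<partial>lborel)"
    by (intro nn_integral_cong) (auto simp: abs_square_le_1 split: split_indicator)
  also have "\<dots> = ennreal pi * (\<integral>\<^sup>+v. ennreal v * indicator {..1} v * indicator {0..} v \<partial>lborel)"
    by (rule nn_integral_lborel_radial) auto
  also have "(\<integral>\<^sup>+v. ennreal v * indicator {..1} v * indicator {0..} v \<partial>lborel) =
      (\<integral>\<^sup>+v. ennreal v * indicator {0..1} v \<partial>lborel)"
    by (intro nn_integral_cong) (auto split: split_indicator)
  also have "\<dots> = ennreal (1\<^sup>2 / 2 - 0\<^sup>2 / 2)"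
    by (rule nn_integral_FTC_Icc) (auto intro!: derivative_eq_intros)
  also have "ennreal pi * ennreal (1\<^sup>2 / 2 - 0\<^sup>2 / 2) = ennreal (pi / 2)"
    by (subst ennreal_mult[symmetric]) auto
  finally show ?thesis .
qed

section \<open>Positive definiteness of the logarithmic energy\<close>

lemma ennreal_eq_top_if_ge_nat:
  assumes "\<And>n::nat. ennreal (real n) \<le> x"
  shows "x = \<infinity>"
proof (rule ccontr)
  assume "x \<noteq> \<infinity>"
  then obtain r where r: "x = ennreal r" "r \<ge> 0" by (cases x) auto
  obtain n :: nat where "r < real n" using reals_Archimedean2 by blast
  then show False using assms[of n] r by (simp add: ennreal_le_iff)
qed

text \<open>The integrand is half the integral of exp (-t s) over s in [a, b]; after exchanging the
  integrals, integration in t leaves 1 / (2 s). Divergence for a = 0 matches the infinite value of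
  \<open>lker\<close> on the diagonal.\<close>

lemma nn_integral_frullani:
  assumes a: "0 \<le> a" "a \<le> b" and b: "0 < b"
  shows "(\<integral>\<^sup>+t. ennreal ((exp (- t * a) - exp (- t * b)) / (2 * t)) * indicator {0<..} t \<partial>lborel)
    = (if a = 0 then \<infinity> else ennreal (ln (b / a) / 2))"
proof -
  let ?g = "\<lambda>t s::real. ennreal (exp (- t * s) / 2) * indicator {a..b} s * indicator {0<..} t"
  have "(\<integral>\<^sup>+t. ennreal ((exp (- t * a) - exp (- t * b)) / (2 * t)) * indicator {0<..} t \<partial>lborel)
    = (\<integral>\<^sup>+t. (\<integral>\<^sup>+s. ?g t s \<partial>lborel) \<partial>lborel)"
  proof (rule nn_integral_cong)
    fix t :: real
    show "ennreal ((exp (- t * a) - exp (- t * b)) / (2 * t)) * indicator {0<..} t = (\<integral>\<^sup>+s. ?g t s \<partial>lborel)"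
    proof (cases "t > 0")
      case True
      have "(\<integral>\<^sup>+s. ?g t s \<partial>lborel) = (\<integral>\<^sup>+s. ennreal (exp (- t * s) / 2) * indicator {a..b} s \<partial>lborel)"
        using True by simp
      also have "\<dots> = ennreal ((- exp (- t * b) / (2 * t)) - (- exp (- t * a) / (2 * t)))"
        using True by (intro nn_integral_FTC_Icc) (auto intro!: derivative_eq_intros simp: a)
      also have "(- exp (- t * b) / (2 * t)) - (- exp (- t * a) / (2 * t)) = (exp (- t * a) - exp (- t * b)) / (2 * t)"
        by (simp add: diff_divide_distrib)
      finally show ?thesis using True by simp
    qed simp
  qed
  also have "\<dots> = (\<integral>\<^sup>+s. (\<integral>\<^sup>+t. ?g t s \<partial>lborel) \<partial>lborel)"
    by (rule lborel_pair.Fubini') measurable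
  also have "\<dots> = (\<integral>\<^sup>+s. ennreal (1 / (2 * s)) * indicator {a..b} s \<partial>lborel)"
  proof (rule nn_integral_cong_AE)
    have "AE s::real in lborel. s \<noteq> 0" by (rule AE_lborel_singleton)
    then show "AE s in lborel. (\<integral>\<^sup>+t. ?g t s \<partial>lborel) = ennreal (1 / (2 * s)) * indicator {a..b} s"
    proof eventually_elim
      case (elim s)
      show ?case
      proof (cases "s \<in> {a..b}")
        case True
        then have s: "s > 0" using elim a by auto
        have "(\<integral>\<^sup>+t. ?g t s \<partial>lborel) = (\<integral>\<^sup>+t. ennreal (exp (- t * s) / 2) * indicator {0..} t \<partial>lborel)"
          using True AE_lborel_singleton[of "0::real"]
          by (intro nn_integral_cong_AE) (auto split: split_indicator elim!: eventually_mono)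
        also have "\<dots> = ennreal (0 - (- exp (- 0 * s) / (2 * s)))"
        proof (rule nn_integral_FTC_atLeast)
          show "((\<lambda>t. - exp (- t * s) / (2 * s)) \<longlongrightarrow> 0) at_top" using s by real_asymp
        qed (use s in \<open>auto intro!: derivative_eq_intros\<close>)
        finally show ?thesis using True by simp
      qed simp
    qed
  qed
  also have "\<dots> = (if a = 0 then \<infinity> else ennreal (ln (b / a) / 2))"
  proof -
    have pos: "(\<integral>\<^sup>+s. ennreal (1 / (2 * s)) * indicator {e..b} s \<partial>lborel) = ennreal (ln (b / e) / 2)"
      if "0 < e" "e \<le> b" for e
    proof -
      have "(\<integral>\<^sup>+s. ennreal (1 / (2 * s)) * indicator {e..b} s \<partial>lborel) = ennreal (ln b / 2 - ln e / 2)"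
        using that by (intro nn_integral_FTC_Icc) (auto intro!: derivative_eq_intros)
      then show ?thesis using that by (simp add: ln_div diff_divide_distrib)
    qed
    have "(\<integral>\<^sup>+s. ennreal (1 / (2 * s)) * indicator {0..b} s \<partial>lborel) = \<infinity>"
    proof (rule ennreal_eq_top_if_ge_nat)
      fix n :: nat
      \<comment> \<open>The lower end is chosen so that ln (b / e) / 2 is exactly n.\<close>
      let ?e = "b * exp (- 2 * real n)"
      have e: "0 < ?e" "?e \<le> b" using b by auto
      have "ennreal (real n) = ennreal (ln (b / ?e) / 2)" using b by (simp add: ln_div ln_mult)
      also have "\<dots> = (\<integral>\<^sup>+s. ennreal (1 / (2 * s)) * indicator {?e..b} s \<partial>lborel)"
        using pos[OF e] by simp
      also have "\<dots> \<le> (\<integral>\<^sup>+s. ennreal (1 / (2 * s)) * indicator {0..b} s \<partial>lborel)"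
        using e by (intro nn_integral_mono) (auto split: split_indicator)
      finally show "ennreal (real n) \<le> (\<integral>\<^sup>+s. ennreal (1 / (2 * s)) * indicator {0..b} s \<partial>lborel)" .
    qed
    then show ?thesis using pos[of a] a by auto
  qed
  finally show ?thesis .
qed

text \<open>The choice a = |z - w|^2 and b = M^2 produces Gaussians, and the factor 1/2 in
  Frullani's integral undoes the squares. The subtracted exp (-t M^2) makes the integral converge
  near t = 0.\<close>

lemma lker_frullani:
  assumes "cmod (z - w) \<le> M" "0 < M"
  shows "lker M z w =
    (\<integral>\<^sup>+t. ennreal ((exp (- t * (cmod (z - w))\<^sup>2) - exp (- t * M\<^sup>2)) / (2 * t)) * indicator {0<..} t \<partial>lborel)"
proof (subst nn_integral_frullani)
  show "lker M z w = (if (cmod (z - w))\<^sup>2 = 0 then \<infinity> else ennreal (ln (M\<^sup>2 / (cmod (z - w))\<^sup>2) / 2))"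
    using assms by (auto simp: lker_def ln_realpow simp flip: power_divide)
qed (use assms in auto)

text \<open>Completing the square around the midpoint of z and w leaves a Gaussian of exponent 4s in
  x, whose integral is pi / (4s). This exhibits exp (-s |z - w|^2) as a convolution square.\<close>

lemma nn_integral_gaussian_product:
  assumes s: "s > 0"
  shows "(\<integral>\<^sup>+x. ennreal (exp (- 2 * s * (cmod (z - x))\<^sup>2)) * ennreal (exp (- 2 * s * (cmod (w - x))\<^sup>2)) \<partial>lborel)
    = ennreal (pi / (4 * s)) * ennreal (exp (- s * (cmod (z - w))\<^sup>2))"
proof -
  have "- 2 * s * (cmod (z - x))\<^sup>2 + - 2 * s * (cmod (w - x))\<^sup>2 =
      - s * (cmod (z - w))\<^sup>2 + - (4 * s) * (cmod ((z + w) / 2 - x))\<^sup>2" for x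
    by (simp add: cmod_power2) (simp add: power2_eq_square field_simps)
  then have "ennreal (exp (- 2 * s * (cmod (z - x))\<^sup>2)) * ennreal (exp (- 2 * s * (cmod (w - x))\<^sup>2)) =
      ennreal (exp (- s * (cmod (z - w))\<^sup>2)) * ennreal (exp (- (4 * s) * (cmod ((z + w) / 2 - x))\<^sup>2))" for x
    by (simp only: ennreal_mult[symmetric] exp_ge_zero exp_add[symmetric])
  then show ?thesis
    using s nn_integral_lborel_gaussian[of "4 * s" "(z + w) / 2"] by (simp add: nn_integral_cmult mult.commute)
qed

text \<open>Convolution of mu with a Gaussian. The exponent is 2s, not s, so that this Gaussian is
  the convolution square root of exp (-s |z - w|^2), up to the factor pi / (4s).\<close>

definition gpot :: "complex measure \<Rightarrow> real \<Rightarrow> complex \<Rightarrow> real" where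
  "gpot \<mu> s x = (\<integral>z. exp (- 2 * s * (cmod (z - x))\<^sup>2) \<partial>\<mu>)"

lemma gpot_measurable[measurable]:
  assumes "sets \<mu> = sets borel" "prob_space \<mu>"
  shows "(\<lambda>(s, x). gpot \<mu> s x) \<in> borel_measurable (borel \<Otimes>\<^sub>M borel)"
proof -
  interpret prob_space \<mu> by fact
  note [measurable_cong] = assms(1)
  show ?thesis unfolding gpot_def by measurable
qed

lemma ennreal_gpot:
  assumes "sets \<mu> = sets borel" "prob_space \<mu>" "s \<ge> 0"
  shows "ennreal (gpot \<mu> s x) = (\<integral>\<^sup>+z. ennreal (exp (- 2 * s * (cmod (z - x))\<^sup>2)) \<partial>\<mu>)"
proof -
  interpret prob_space \<mu> by fact
  note [measurable_cong] = assms(1)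
  have "integrable \<mu> (\<lambda>z. exp (- 2 * s * (cmod (z - x))\<^sup>2))"
    by (rule integrable_const_bound[of _ 1]) (use assms in auto)
  then show ?thesis unfolding gpot_def by (subst nn_integral_eq_integral) auto
qed

lemma gpot_nonneg: "gpot \<mu> s x \<ge> 0"
  unfolding gpot_def by (rule integral_nonneg_AE) simp

text \<open>Tonelli turns the L2 inner product of two smoothed measures into their mutual Gaussian
  energy; this is the source of positivity.\<close>

lemma nn_integral_gpot_mult:
  assumes mu: "sets \<mu> = sets borel" "prob_space \<mu>" and nu: "sets \<nu> = sets borel" "prob_space \<nu>" and s: "s > 0"
  shows "(\<integral>\<^sup>+x. ennreal (gpot \<mu> s x * gpot \<nu> s x) \<partial>lborel) =
    ennreal (pi / (4 * s)) * (\<integral>\<^sup>+z. (\<integral>\<^sup>+w. ennreal (exp (- s * (cmod (z - w))\<^sup>2)) \<partial>\<nu>) \<partial>\<mu>)"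
proof -
  interpret mu: prob_space \<mu> by fact
  interpret nu: prob_space \<nu> by fact
  interpret p1: pair_sigma_finite \<mu> "lborel :: complex measure" ..
  interpret p2: pair_sigma_finite \<nu> "lborel :: complex measure" ..
  note [measurable_cong] = mu(1) nu(1)
  let ?e = "\<lambda>z x. ennreal (exp (- 2 * s * (cmod (z - x))\<^sup>2))"
  have "(\<integral>\<^sup>+x. ennreal (gpot \<mu> s x * gpot \<nu> s x) \<partial>lborel) = (\<integral>\<^sup>+x. (\<integral>\<^sup>+z. ?e z x \<partial>\<mu>) * (\<integral>\<^sup>+w. ?e w x \<partial>\<nu>) \<partial>lborel)"
    using s by (simp add: ennreal_mult gpot_nonneg ennreal_gpot mu nu)
  also have "\<dots> = (\<integral>\<^sup>+x. (\<integral>\<^sup>+z. (\<integral>\<^sup>+w. ?e z x * ?e w x \<partial>\<nu>) \<partial>\<mu>) \<partial>lborel)"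
    by (intro nn_integral_cong, subst nn_integral_multc[symmetric], measurable, 
        intro nn_integral_cong, subst nn_integral_cmult[symmetric], measurable)
  also have "\<dots> = (\<integral>\<^sup>+z. (\<integral>\<^sup>+x. (\<integral>\<^sup>+w. ?e z x * ?e w x \<partial>\<nu>) \<partial>lborel) \<partial>\<mu>)"
    by (rule p1.Fubini') measurable
  also have "\<dots> = (\<integral>\<^sup>+z. (\<integral>\<^sup>+w. (\<integral>\<^sup>+x. ?e z x * ?e w x \<partial>lborel) \<partial>\<nu>) \<partial>\<mu>)"
    by (intro nn_integral_cong p2.Fubini') measurable
  also have "\<dots> = (\<integral>\<^sup>+z. (\<integral>\<^sup>+w. ennreal (pi / (4 * s)) * ennreal (exp (- s * (cmod (z - w))\<^sup>2)) \<partial>\<nu>) \<partial>\<mu>)"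
    using nn_integral_gaussian_product[OF s] by simp
  also have "\<dots> = ennreal (pi / (4 * s)) * (\<integral>\<^sup>+z. (\<integral>\<^sup>+w. ennreal (exp (- s * (cmod (z - w))\<^sup>2)) \<partial>\<nu>) \<partial>\<mu>)"
    by (subst nn_integral_cmult, measurable, subst nn_integral_cmult, measurable)
  finally show ?thesis .
qed

section \<open>Mutual energies of probability measures on a disk\<close>

definition lenergy :: "real \<Rightarrow> complex measure \<Rightarrow> complex measure \<Rightarrow> ennreal" where
  "lenergy M \<mu> \<nu> = (\<integral>\<^sup>+z. (\<integral>\<^sup>+w. lker M z w \<partial>\<nu>) \<partial>\<mu>)"

text \<open>The integrand of \<open>lker_frullani\<close> at one value of t, without the weight 1 /
  (2t). The subtraction is made between reals, before \<open>ennreal\<close>; for s > 0 it is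
  nonnegative where |z - w| <= M.\<close>

definition genergy :: "real \<Rightarrow> real \<Rightarrow> complex measure \<Rightarrow> complex measure \<Rightarrow> ennreal" where
  "genergy M s \<mu> \<nu> = (\<integral>\<^sup>+z. (\<integral>\<^sup>+w. ennreal (exp (- s * (cmod (z - w))\<^sup>2) - exp (- s * M\<^sup>2)) \<partial>\<nu>) \<partial>\<mu>)"

lemma cmod_diff_le:
  assumes "z \<in> cball 0 L" "w \<in> cball 0 L" shows "cmod (z - w) \<le> 2 * L"
  using norm_triangle_ineq4[of z w] assms by simp

text \<open>Since both measures have mass 1, the subtracted constant amounts to the same number for
  every pair of measures, and can be cancelled later.\<close>

lemma gaussian_double_integral:
  assumes mu: "sets \<mu> = sets borel" "prob_space \<mu>" "AE z in \<mu>. z \<in> cball 0 L"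
    and nu: "sets \<nu> = sets borel" "prob_space \<nu>" "AE z in \<nu>. z \<in> cball 0 L" and s: "s > 0"
  shows "(\<integral>\<^sup>+z. (\<integral>\<^sup>+w. ennreal (exp (- s * (cmod (z - w))\<^sup>2)) \<partial>\<nu>) \<partial>\<mu>) =
    genergy (2 * L) s \<mu> \<nu> + ennreal (exp (- s * (2 * L)\<^sup>2))"
proof -
  interpret mu: prob_space \<mu> by fact
  interpret nu: prob_space \<nu> by fact
  note [measurable_cong] = mu(1) nu(1)
  let ?e = "\<lambda>z w. exp (- s * (cmod (z - w))\<^sup>2)" and ?c = "exp (- s * (2 * L)\<^sup>2)"
  have "(\<integral>\<^sup>+z. (\<integral>\<^sup>+w. ennreal (?e z w) \<partial>\<nu>) \<partial>\<mu>) = (\<integral>\<^sup>+z. (\<integral>\<^sup>+w. ennreal (?e z w - ?c) + ennreal ?c \<partial>\<nu>) \<partial>\<mu>)"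
  proof (rule nn_integral_cong_AE, use mu(3) in eventually_elim)
    case (elim z)
    show ?case
    proof (rule nn_integral_cong_AE, use nu(3) in eventually_elim)
      fix w :: complex assume "w \<in> cball 0 L"
      then have "(cmod (z - w))\<^sup>2 \<le> (2 * L)\<^sup>2" using cmod_diff_le[OF elim] by (intro power_mono) auto
      then have "?c \<le> ?e z w" using s by simp
      then show "ennreal (?e z w) = ennreal (?e z w - ?c) + ennreal ?c" by (simp flip: ennreal_plus)
    qed
  qed
  also have "\<dots> = genergy (2 * L) s \<mu> \<nu> + ennreal ?c"
    unfolding genergy_def
    by (subst nn_integral_add, measurable, subst nn_integral_add, measurable)
       (simp add: mu.emeasure_space_1 nu.emeasure_space_1)
  finally show ?thesis .
qed

text \<open>This is a^2 + b^2 = 2 a b + (a - b)^2 for the two smoothings, integrated. The cross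
  terms are kept on the right because subtraction in \<open>ennreal\<close> truncates. The factor 4s
  / pi is the inverse of the one in \<open>nn_integral_gaussian_product\<close>.\<close>

lemma genergy_identity:
  assumes mu: "sets \<mu> = sets borel" "prob_space \<mu>" "AE z in \<mu>. z \<in> cball 0 L"
    and nu: "sets \<nu> = sets borel" "prob_space \<nu>" "AE z in \<nu>. z \<in> cball 0 L" and s: "s > 0"
  shows "genergy (2 * L) s \<mu> \<mu> + genergy (2 * L) s \<nu> \<nu> =
    (genergy (2 * L) s \<mu> \<nu> + genergy (2 * L) s \<mu> \<nu>)
    + ennreal (4 * s / pi) * (\<integral>\<^sup>+x. ennreal ((gpot \<mu> s x - gpot \<nu> s x)\<^sup>2) \<partial>lborel)"
proof -
  let ?G = "\<lambda>\<mu> \<nu>. \<integral>\<^sup>+x. ennreal (gpot \<mu> s x * gpot \<nu> s x) \<partial>lborel"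
  let ?H = "\<lambda>\<mu> \<nu>. \<integral>\<^sup>+z. (\<integral>\<^sup>+w. ennreal (exp (- s * (cmod (z - w))\<^sup>2)) \<partial>\<nu>) \<partial>\<mu>"
  let ?A = "genergy (2 * L) s" and ?e = "ennreal (exp (- s * (2 * L)\<^sup>2))"
  let ?Q = "\<integral>\<^sup>+x. ennreal ((gpot \<mu> s x - gpot \<nu> s x)\<^sup>2) \<partial>lborel"
  let ?c = "ennreal (pi / (4 * s))" and ?k = "ennreal (4 * s / pi)"
  note [measurable] = gpot_measurable[OF mu(1,2)] gpot_measurable[OF nu(1,2)]
  have "ennreal (a * a) + ennreal (b * b) = (ennreal (a * b) + ennreal (a * b)) + ennreal ((a - b)\<^sup>2)"
    if "a \<ge> 0" "b \<ge> 0" for a b :: real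
  proof -
    have "ennreal (a * a) + ennreal (b * b) = ennreal (a * a + b * b)" using that by simp
    also have "a * a + b * b = (a * b + a * b) + (a - b)\<^sup>2" by (simp add: power2_eq_square algebra_simps)
    also have "ennreal \<dots> = (ennreal (a * b) + ennreal (a * b)) + ennreal ((a - b)\<^sup>2)"
      using that by (simp only: ennreal_plus add_nonneg_nonneg mult_nonneg_nonneg zero_le_power2)
    finally show ?thesis .
  qed
  then have "?G \<mu> \<mu> + ?G \<nu> \<nu> = (?G \<mu> \<nu> + ?G \<mu> \<nu>) + ?Q"
    by (simp add: nn_integral_add[symmetric] gpot_nonneg)
  \<comment> \<open>Inserting a product equal to 1 gives every term the factor \<open>?c\<close>,
    which is then cancelled.\<close>
  also have "?Q = ?c * (?k * ?Q)"
    using s by (simp add: mult.assoc[symmetric] ennreal_mult[symmetric])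
  finally have "?c * (?H \<mu> \<mu> + ?H \<nu> \<nu>) = ?c * ((?H \<mu> \<nu> + ?H \<mu> \<nu>) + ?k * ?Q)"
    using s by (simp only: nn_integral_gpot_mult[OF mu(1,2) mu(1,2)] nn_integral_gpot_mult[OF mu(1,2) nu(1,2)]
        nn_integral_gpot_mult[OF nu(1,2) nu(1,2)] distrib_left)
  then have "?H \<mu> \<mu> + ?H \<nu> \<nu> = (?H \<mu> \<nu> + ?H \<mu> \<nu>) + ?k * ?Q"
    using s by (subst (asm) ennreal_mult_cancel_left) auto
  then have "(?e + ?e) + (?A \<mu> \<mu> + ?A \<nu> \<nu>) = (?e + ?e) + ((?A \<mu> \<nu> + ?A \<mu> \<nu>) + ?k * ?Q)"
    by (simp only: gaussian_double_integral[OF mu mu s] gaussian_double_integral[OF mu nu s]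
        gaussian_double_integral[OF nu nu s] ac_simps)
  then show ?thesis by (subst (asm) ennreal_add_left_cancel) auto
qed

lemma lenergy_eq_genergy:
  assumes mu: "sets \<mu> = sets borel" "prob_space \<mu>" "AE z in \<mu>. z \<in> cball 0 L"
    and nu: "sets \<nu> = sets borel" "prob_space \<nu>" "AE z in \<nu>. z \<in> cball 0 L" and L: "L > 0"
  shows "lenergy (2 * L) \<mu> \<nu> = (\<integral>\<^sup>+t. ennreal (1 / (2 * t)) * genergy (2 * L) t \<mu> \<nu> * indicator {0<..} t \<partial>lborel)"
proof -
  interpret mu: prob_space \<mu> by fact
  interpret nu: prob_space \<nu> by fact
  interpret p1: pair_sigma_finite \<mu> "lborel :: real measure" ..
  interpret p2: pair_sigma_finite \<nu> "lborel :: real measure" ..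
  note [measurable_cong] = mu(1) nu(1)
  let ?d = "\<lambda>t z w. exp (- t * (cmod (z - w))\<^sup>2) - exp (- t * (2 * L)\<^sup>2)"
  let ?f = "\<lambda>z w t. ennreal (?d t z w / (2 * t)) * indicator {0<..} t"
  have "lenergy (2 * L) \<mu> \<nu> = (\<integral>\<^sup>+z. (\<integral>\<^sup>+w. (\<integral>\<^sup>+t. ?f z w t \<partial>lborel) \<partial>\<nu>) \<partial>\<mu>)"
    unfolding lenergy_def
  proof (rule nn_integral_cong_AE, use mu(3) in eventually_elim)
    case (elim z)
    show ?case
    proof (rule nn_integral_cong_AE, use nu(3) in eventually_elim)
      fix w :: complex assume "w \<in> cball 0 L"
      then show "lker (2 * L) z w = (\<integral>\<^sup>+t. ?f z w t \<partial>lborel)"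
        using cmod_diff_le[OF elim] L by (intro lker_frullani) auto
    qed
  qed
  also have "\<dots> = (\<integral>\<^sup>+z. (\<integral>\<^sup>+t. (\<integral>\<^sup>+w. ?f z w t \<partial>\<nu>) \<partial>lborel) \<partial>\<mu>)"
    by (intro nn_integral_cong p2.Fubini'[symmetric]) measurable
  also have "\<dots> = (\<integral>\<^sup>+t. (\<integral>\<^sup>+z. (\<integral>\<^sup>+w. ?f z w t \<partial>\<nu>) \<partial>\<mu>) \<partial>lborel)"
    by (intro p1.Fubini'[symmetric]) measurable
  also have "\<dots> = (\<integral>\<^sup>+t. ennreal (1 / (2 * t)) * genergy (2 * L) t \<mu> \<nu> * indicator {0<..} t \<partial>lborel)"
  proof (rule nn_integral_cong)
    fix t :: real
    have f: "?f z w t = (ennreal (1 / (2 * t)) * indicator {0<..} t) * ennreal (?d t z w)" for z w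
      by (auto split: split_indicator simp: ennreal_mult'[symmetric])
    show "(\<integral>\<^sup>+z. (\<integral>\<^sup>+w. ?f z w t \<partial>\<nu>) \<partial>\<mu>) = ennreal (1 / (2 * t)) * genergy (2 * L) t \<mu> \<nu> * indicator {0<..} t"
      unfolding f genergy_def
      by (subst nn_integral_cmult, measurable, subst nn_integral_cmult, measurable) (simp add: mult_ac)
  qed
  finally show ?thesis .
qed

text \<open>The last term is the energy of the neutral measure mu - nu. It arises by integrating
  \<open>genergy_identity\<close> against dt / (2t), where (4t / pi) / (2t) = 2 / pi. The additive
  form remains valid when some of the energies are infinite.\<close>

lemma lenergy_identity:
  assumes mu: "sets \<mu> = sets borel" "prob_space \<mu>" "AE z in \<mu>. z \<in> cball 0 L"
    and nu: "sets \<nu> = sets borel" "prob_space \<nu>" "AE z in \<nu>. z \<in> cball 0 L" and L: "L > 0"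
  shows "lenergy (2 * L) \<mu> \<mu> + lenergy (2 * L) \<nu> \<nu> = (lenergy (2 * L) \<mu> \<nu> + lenergy (2 * L) \<mu> \<nu>) +
    (\<integral>\<^sup>+t. ennreal (2 / pi) * (\<integral>\<^sup>+x. ennreal ((gpot \<mu> t x - gpot \<nu> t x)\<^sup>2) \<partial>lborel) * indicator {0<..} t \<partial>lborel)"
proof -
  interpret mu: prob_space \<mu> by fact
  interpret nu: prob_space \<nu> by fact
  note [measurable_cong] = mu(1) nu(1)
  note [measurable] = gpot_measurable[OF mu(1,2)] gpot_measurable[OF nu(1,2)]
  let ?A = "\<lambda>t. genergy (2 * L) t"
  let ?Q = "\<lambda>t. \<integral>\<^sup>+x. ennreal ((gpot \<mu> t x - gpot \<nu> t x)\<^sup>2) \<partial>lborel"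
  have [measurable]: "(\<lambda>t. ?A t \<mu> \<mu>) \<in> borel_measurable borel" "(\<lambda>t. ?A t \<nu> \<nu>) \<in> borel_measurable borel"
     "(\<lambda>t. ?A t \<mu> \<nu>) \<in> borel_measurable borel"
    unfolding genergy_def by measurable
  have "lenergy (2 * L) \<mu> \<mu> + lenergy (2 * L) \<nu> \<nu> =
    (\<integral>\<^sup>+t. ennreal (1 / (2 * t)) * (?A t \<mu> \<mu> + ?A t \<nu> \<nu>) * indicator {0<..} t \<partial>lborel)"
    unfolding lenergy_eq_genergy[OF mu mu L] lenergy_eq_genergy[OF nu nu L]
    by (subst nn_integral_add[symmetric], measurable) (simp add: distrib_left distrib_right)
  also have "\<dots> = (\<integral>\<^sup>+t. (ennreal (1 / (2 * t)) * ?A t \<mu> \<nu> * indicator {0<..} t + ennreal (1 / (2 * t)) * ?A t \<mu> \<nu> * indicator {0<..} t)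
      + ennreal (2 / pi) * ?Q t * indicator {0<..} t \<partial>lborel)"
  proof (rule nn_integral_cong)
    fix t :: real
    show "ennreal (1 / (2 * t)) * (?A t \<mu> \<mu> + ?A t \<nu> \<nu>) * indicator {0<..} t =
      (ennreal (1 / (2 * t)) * ?A t \<mu> \<nu> * indicator {0<..} t + ennreal (1 / (2 * t)) * ?A t \<mu> \<nu> * indicator {0<..} t)
      + ennreal (2 / pi) * ?Q t * indicator {0<..} t"
    proof (cases "t > 0")
      case True
      have "ennreal (1 / (2 * t)) * ennreal (4 * t / pi) = ennreal (2 / pi)"
        using True by (subst ennreal_mult[symmetric]) auto
      then show ?thesis using True
        by (simp add: genergy_identity[OF mu nu True] distrib_left mult.assoc[symmetric])
    qed simp
  qed
  also have "\<dots> = (lenergy (2 * L) \<mu> \<nu> + lenergy (2 * L) \<mu> \<nu>) +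
    (\<integral>\<^sup>+t. ennreal (2 / pi) * ?Q t * indicator {0<..} t \<partial>lborel)"
    unfolding lenergy_eq_genergy[OF mu nu L]
    by (subst nn_integral_add, measurable, subst nn_integral_add, measurable)
  finally show ?thesis .
qed

section \<open>Recovering a measure from its Gaussian smoothings\<close>

lemma nn_integral_lborel_scale:
  fixes g :: "complex \<Rightarrow> ennreal"
  assumes [measurable]: "g \<in> borel_measurable borel" and c: "c > 0"
  shows "(\<integral>\<^sup>+x. g x \<partial>lborel) = ennreal (c\<^sup>2) * (\<integral>\<^sup>+y. g (z + c *\<^sub>R y) \<partial>lborel)"
  using c by (subst lborel_affine[of c z]) (auto simp: nn_integral_density nn_integral_distr nn_integral_cmult)

text \<open>The factor 2 / (pi c^2) normalises the kernel of \<open>gpot\<close> at s = 1 / c^2.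
  Substituting x = z + c y turns it into a fixed probability density and moves n into the argument
  of \<open>f\<close>, so dominated convergence applies.\<close>

lemma gaussian_mollify_tendsto:
  fixes f :: "complex \<Rightarrow> real"
  assumes f: "continuous_on UNIV f" "\<And>x. 0 \<le> f x" "\<And>x. f x \<le> 1"
    and c: "\<And>n. c n > 0" "c \<longlonglongrightarrow> 0"
  defines "\<phi> \<equiv> \<lambda>n z. \<integral>\<^sup>+x. ennreal (f x) * ennreal (2 / (pi * (c n)\<^sup>2) * exp (- 2 * (1 / (c n)\<^sup>2) * (cmod (z - x))\<^sup>2)) \<partial>lborel"
  shows "\<phi> n z \<le> 1" "(\<lambda>n. \<phi> n z) \<longlonglongrightarrow> ennreal (f z)"
proof -
  have [measurable]: "f \<in> borel_measurable borel" using f(1) by (rule borel_measurable_continuous_onI)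
  let ?g = "\<lambda>y. ennreal (2 / pi * exp (- 2 * (cmod y)\<^sup>2))"
  have g: "(\<integral>\<^sup>+y. ?g y \<partial>lborel) = 1"
  proof -
    have "(\<integral>\<^sup>+y. ?g y \<partial>lborel) = ennreal (2 / pi) * (\<integral>\<^sup>+y. ennreal (exp (- 2 * (cmod (0 - y))\<^sup>2)) \<partial>lborel)"
      by (subst nn_integral_cmult[symmetric]) (auto simp flip: ennreal_mult)
    also have "\<dots> = ennreal (2 / pi) * ennreal (pi / 2)" by (subst nn_integral_lborel_gaussian) auto
    also have "\<dots> = 1" by (subst ennreal_mult[symmetric]) auto
    finally show ?thesis .
  qed
  have phi: "\<phi> n z = (\<integral>\<^sup>+y. ennreal (f (z + c n *\<^sub>R y)) * ?g y \<partial>lborel)" for n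
  proof -
    have "\<phi> n z = ennreal ((c n)\<^sup>2) * (\<integral>\<^sup>+y. ennreal (f (z + c n *\<^sub>R y)) *
       ennreal (2 / (pi * (c n)\<^sup>2) * exp (- 2 * (1 / (c n)\<^sup>2) * (cmod (z - (z + c n *\<^sub>R y)))\<^sup>2)) \<partial>lborel)"
      unfolding \<phi>_def by (rule nn_integral_lborel_scale) (use c in auto)
    also have "\<dots> = (\<integral>\<^sup>+y. ennreal ((c n)\<^sup>2) * (ennreal (f (z + c n *\<^sub>R y)) *
       ennreal (2 / (pi * (c n)\<^sup>2) * exp (- 2 * (1 / (c n)\<^sup>2) * (cmod (z - (z + c n *\<^sub>R y)))\<^sup>2))) \<partial>lborel)"
      by (rule nn_integral_cmult[symmetric]) measurable
    also have "\<dots> = (\<integral>\<^sup>+y. ennreal (f (z + c n *\<^sub>R y)) * ?g y \<partial>lborel)"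
    proof (rule nn_integral_cong)
      fix y
      have cn: "c n \<noteq> 0" using c(1)[of n] by simp
      have "- 2 * (1 / (c n)\<^sup>2) * (cmod (z - (z + c n *\<^sub>R y)))\<^sup>2 = - 2 * (cmod y)\<^sup>2"
        using cn by (simp add: power_mult_distrib)
      moreover have "(c n)\<^sup>2 * (2 / (pi * (c n)\<^sup>2) * r) = 2 / pi * r" for r
        using cn by simp
      ultimately have "(c n)\<^sup>2 * (2 / (pi * (c n)\<^sup>2) * exp (- 2 * (1 / (c n)\<^sup>2) * (cmod (z - (z + c n *\<^sub>R y)))\<^sup>2))
        = 2 / pi * exp (- 2 * (cmod y)\<^sup>2)" by (simp only:)
      then have eq: "ennreal ((c n)\<^sup>2) * ennreal (2 / (pi * (c n)\<^sup>2) * exp (- 2 * (1 / (c n)\<^sup>2) * (cmod (z - (z + c n *\<^sub>R y)))\<^sup>2)) = ?g y"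
        by (subst ennreal_mult[symmetric]) auto
      show "ennreal ((c n)\<^sup>2) * (ennreal (f (z + c n *\<^sub>R y)) *
         ennreal (2 / (pi * (c n)\<^sup>2) * exp (- 2 * (1 / (c n)\<^sup>2) * (cmod (z - (z + c n *\<^sub>R y)))\<^sup>2)))
         = ennreal (f (z + c n *\<^sub>R y)) * ?g y"
        by (subst mult.left_commute) (simp only: eq)
    qed
    finally show ?thesis .
  qed
  have le: "ennreal (f x) * ?g y \<le> ?g y" for x y
  proof -
    have "ennreal (f x) \<le> 1" using f(3) by simp
    from mult_right_mono[OF this, of "?g y"] show ?thesis by simp
  qed
  have "\<phi> n z \<le> (\<integral>\<^sup>+y. ?g y \<partial>lborel)" unfolding phi by (intro nn_integral_mono le)
  then show "\<phi> n z \<le> 1" using g by simp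
  have "(\<lambda>n. \<phi> n z) \<longlonglongrightarrow> (\<integral>\<^sup>+y. ennreal (f z) * ?g y \<partial>lborel)"
    unfolding phi
  proof (rule nn_integral_dominated_convergence[where w = ?g])
    show "AE y in lborel. (\<lambda>n. ennreal (f (z + c n *\<^sub>R y)) * ?g y) \<longlonglongrightarrow> ennreal (f z) * ?g y"
    proof (rule AE_I2)
      fix y
      have "(\<lambda>n. z + c n *\<^sub>R y) \<longlonglongrightarrow> z + 0 *\<^sub>R y" by (intro tendsto_intros c)
      then have "(\<lambda>n. f (z + c n *\<^sub>R y)) \<longlonglongrightarrow> f z"
        using f(1) by (auto simp: continuous_on_eq_continuous_at isCont_def intro: isCont_tendsto_compose[of z f])
      then show "(\<lambda>n. ennreal (f (z + c n *\<^sub>R y)) * ?g y) \<longlonglongrightarrow> ennreal (f z) * ?g y"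
        by (intro tendsto_intros ennreal_tendsto_cmult tendsto_mult_ennreal) auto
    qed
  qed (use le g in auto)
  also have "(\<integral>\<^sup>+y. ennreal (f z) * ?g y \<partial>lborel) = ennreal (f z)"
    by (subst nn_integral_cmult, measurable, simp only: g mult_1_right)
  finally show "(\<lambda>n. \<phi> n z) \<longlonglongrightarrow> ennreal (f z)" .
qed

text \<open>Exchanging the integrals moves the smoothing from mu onto \<open>f\<close>, where it
  converges boundedly.\<close>

lemma gpot_mollify_tendsto:
  fixes f :: "complex \<Rightarrow> real"
  assumes mu: "sets \<mu> = sets borel" "prob_space \<mu>"
    and f: "continuous_on UNIV f" "\<And>x. 0 \<le> f x" "\<And>x. f x \<le> 1"
    and c: "\<And>n. c n > 0" "c \<longlonglongrightarrow> 0"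
  shows "(\<lambda>n. \<integral>\<^sup>+x. ennreal (f x) * ennreal (2 / (pi * (c n)\<^sup>2)) * ennreal (gpot \<mu> (1 / (c n)\<^sup>2) x) \<partial>lborel)
    \<longlonglongrightarrow> (\<integral>\<^sup>+z. ennreal (f z) \<partial>\<mu>)"
proof -
  interpret mu: prob_space \<mu> by fact
  interpret p1: pair_sigma_finite \<mu> "lborel :: complex measure" ..
  note [measurable_cong] = mu(1)
  have [measurable]: "f \<in> borel_measurable borel" using f(1) by (rule borel_measurable_continuous_onI)
  let ?\<phi> = "\<lambda>n z. \<integral>\<^sup>+x. ennreal (f x) * ennreal (2 / (pi * (c n)\<^sup>2) * exp (- 2 * (1 / (c n)\<^sup>2) * (cmod (z - x))\<^sup>2)) \<partial>lborel"
  have "(\<integral>\<^sup>+x. ennreal (f x) * ennreal (2 / (pi * (c n)\<^sup>2)) * ennreal (gpot \<mu> (1 / (c n)\<^sup>2) x) \<partial>lborel)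
    = (\<integral>\<^sup>+z. ?\<phi> n z \<partial>\<mu>)" for n
  proof -
    have "(\<integral>\<^sup>+x. ennreal (f x) * ennreal (2 / (pi * (c n)\<^sup>2)) * ennreal (gpot \<mu> (1 / (c n)\<^sup>2) x) \<partial>lborel) =
      (\<integral>\<^sup>+x. (\<integral>\<^sup>+z. ennreal (f x) * ennreal (2 / (pi * (c n)\<^sup>2) * exp (- 2 * (1 / (c n)\<^sup>2) * (cmod (z - x))\<^sup>2)) \<partial>\<mu>) \<partial>lborel)"
      by (subst ennreal_gpot[OF mu], simp, subst nn_integral_cmult[symmetric], measurable)
         (simp add: mult.assoc flip: ennreal_mult)
    also have "\<dots> = (\<integral>\<^sup>+z. ?\<phi> n z \<partial>\<mu>)"
      by (rule p1.Fubini') measurable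
    finally show ?thesis .
  qed
  moreover have "(\<lambda>n. \<integral>\<^sup>+z. ?\<phi> n z \<partial>\<mu>) \<longlonglongrightarrow> (\<integral>\<^sup>+z. ennreal (f z) \<partial>\<mu>)"
  proof (rule nn_integral_dominated_convergence[where w = "\<lambda>_. 1"])
    show "AE z in \<mu>. ?\<phi> n z \<le> 1" for n
      using gaussian_mollify_tendsto(1)[OF f c] by simp
    show "AE z in \<mu>. (\<lambda>n. ?\<phi> n z) \<longlonglongrightarrow> ennreal (f z)"
      using gaussian_mollify_tendsto(2)[OF f c] by simp
  qed (auto simp: mu.emeasure_space_1)
  ultimately show ?thesis by simp
qed

text \<open>Closed sets form an intersection-stable generator, and the indicator of a nonempty
  closed set is a limit of continuous cutoffs \<open>?f n\<close>. The empty set is treated apart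
  because \<open>infdist\<close> to it is 0.\<close>

lemma finite_measure_eqI_continuous:
  fixes \<mu> \<nu> :: "'a::metric_space measure"
  assumes mu: "sets \<mu> = sets borel" "finite_measure \<mu>" and nu: "sets \<nu> = sets borel" "finite_measure \<nu>"
    and eq: "\<And>f :: 'a \<Rightarrow> real. continuous_on UNIV f \<Longrightarrow> (\<And>x. 0 \<le> f x) \<Longrightarrow> (\<And>x. f x \<le> 1) \<Longrightarrow>
      (\<integral>\<^sup>+x. ennreal (f x) \<partial>\<mu>) = (\<integral>\<^sup>+x. ennreal (f x) \<partial>\<nu>)"
  shows "\<mu> = \<nu>"
proof (rule measure_eqI_generator_eq[where E = "Collect closed" and \<Omega> = UNIV and A = "\<lambda>_. UNIV"])
  interpret mu: finite_measure \<mu> by fact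
  interpret nu: finite_measure \<nu> by fact
  show "sets \<mu> = sigma_sets UNIV (Collect closed)" "sets \<nu> = sigma_sets UNIV (Collect closed)"
    using mu nu by (simp_all add: borel_eq_closed)
  show "Int_stable (Collect closed)" by (auto simp: Int_stable_def)
  fix X :: "'a set" assume "X \<in> Collect closed"
  then have X: "closed X" by simp
  show "emeasure \<mu> X = emeasure \<nu> X"
  proof (cases "X = {}")
    case False
    let ?f = "\<lambda>n x. max 0 (1 - real n * infdist x X)"
    have cont: "continuous_on UNIV (?f n)" for n by (intro continuous_intros)
    have lim: "(\<lambda>n. ennreal (?f n x)) \<longlonglongrightarrow> indicator X x" for x
    proof (cases "x \<in> X")
      case True
      then show ?thesis by simp
    next
      case False
      then have "infdist x X > 0"
        using X \<open>X \<noteq> {}\<close> by (metis in_closed_iff_infdist_zero infdist_nonneg less_eq_real_def)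
      then obtain N :: nat where N: "1 < real N * infdist x X" using reals_Archimedean3 by blast
      have "1 \<le> real n * infdist x X" if "n \<ge> N" for n
        using N that infdist_nonneg[of x X] mult_right_mono[of "real N" "real n" "infdist x X"] by simp
      then have "eventually (\<lambda>n. real n * infdist x X \<ge> 1) sequentially"
        by (auto simp: eventually_sequentially)
      then have "eventually (\<lambda>n. ennreal (?f n x) = 0) sequentially"
        by eventually_elim simp
      then show ?thesis using False by (simp add: tendsto_eventually)
    qed
    have conv: "(\<lambda>n. \<integral>\<^sup>+x. ennreal (?f n x) \<partial>M) \<longlonglongrightarrow> emeasure M X"
      if [measurable_cong]: "sets M = sets borel" and "finite_measure M" for M :: "'a measure"
    proof -
      interpret M: finite_measure M by fact
      have [measurable]: "X \<in> sets borel" using X by simp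
      have "(\<lambda>n. \<integral>\<^sup>+x. ennreal (?f n x) \<partial>M) \<longlonglongrightarrow> (\<integral>\<^sup>+x. indicator X x \<partial>M)"
      proof (rule nn_integral_dominated_convergence[where w = "\<lambda>_. 1"])
        show "(\<lambda>x. ennreal (?f n x)) \<in> borel_measurable M" for n
          using borel_measurable_continuous_onI[OF cont[of n]] by measurable
      qed (use lim X in \<open>auto simp: M.emeasure_finite top.not_eq_extremum[symmetric] that(1) infdist_nonneg ennreal_le_1\<close>)
      then show ?thesis using X by (simp add: that(1))
    qed
    have "(\<integral>\<^sup>+x. ennreal (?f n x) \<partial>\<mu>) = (\<integral>\<^sup>+x. ennreal (?f n x) \<partial>\<nu>)" for n
      by (rule eq[OF cont]) (auto simp: infdist_nonneg)
    with conv[OF mu] conv[OF nu] show ?thesis by (metis (no_types, lifting) LIMSEQ_unique ext)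
  qed simp
next
  show "emeasure \<mu> UNIV \<noteq> \<infinity>"
    using finite_measure.emeasure_finite[OF mu(2)] by simp
qed auto

text \<open>Cancelling the finite mutual energy in \<open>lenergy_identity\<close> leaves
  \<open>?D\<close> = 0, so for almost every t the two smoothings agree almost everywhere. Letting
  such t tend to infinity recovers the measures.\<close>

lemma lenergy_eq_imp_eq:
  assumes mu: "sets \<mu> = sets borel" "prob_space \<mu>" "AE z in \<mu>. z \<in> cball 0 L"
    and nu: "sets \<nu> = sets borel" "prob_space \<nu>" "AE z in \<nu>. z \<in> cball 0 L" and L: "L > 0"
    and le: "lenergy (2 * L) \<mu> \<mu> + lenergy (2 * L) \<nu> \<nu> \<le> lenergy (2 * L) \<mu> \<nu> + lenergy (2 * L) \<mu> \<nu>"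
    and fin: "lenergy (2 * L) \<mu> \<nu> \<noteq> \<infinity>"
  shows "\<mu> = \<nu>"
proof -
  interpret mu: prob_space \<mu> by fact
  interpret nu: prob_space \<nu> by fact
  note [measurable] = gpot_measurable[OF mu(1,2)] gpot_measurable[OF nu(1,2)]
  let ?Q = "\<lambda>t. \<integral>\<^sup>+x. ennreal ((gpot \<mu> t x - gpot \<nu> t x)\<^sup>2) \<partial>lborel"
  let ?D = "\<integral>\<^sup>+t. ennreal (2 / pi) * ?Q t * indicator {0<..} t \<partial>lborel"
  let ?E = "lenergy (2 * L) \<mu> \<nu> + lenergy (2 * L) \<mu> \<nu>"
  have "?E + ?D \<le> ?E + 0" using le lenergy_identity[OF mu nu L] by simp
  then have "?D = 0" using fin by (subst (asm) ennreal_add_left_cancel_le) auto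
  then have AE: "AE t in lborel. ennreal (2 / pi) * ?Q t * indicator {0<..} t = 0"
    by (subst (asm) nn_integral_0_iff_AE) measurable
  \<comment> \<open>Almost every positive t is good, so there is one in (N, N + 1), an interval of
    positive length.\<close>
  have "\<exists>t > real N. AE x in lborel. gpot \<mu> t x = gpot \<nu> t x" for N
  proof (rule ccontr)
    assume contra: "\<not> ?thesis"
    have nz: "?Q t \<noteq> 0" if "t > real N" for t
    proof
      assume "?Q t = 0"
      then have "AE x in lborel. ennreal ((gpot \<mu> t x - gpot \<nu> t x)\<^sup>2) = 0"
        by (subst (asm) nn_integral_0_iff_AE) measurable
      then have "AE x in lborel. gpot \<mu> t x = gpot \<nu> t x" by eventually_elim simp
      then show False using contra that by blast
    qed
    from AE have "AE t in lborel. t \<notin> {real N<..<real N + 1}"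
    proof eventually_elim
      case (elim t)
      then show ?case using nz[of t] by (auto split: split_indicator_asm)
    qed
    then have "{real N<..<real N + 1} \<in> null_sets lborel"
      by (subst AE_iff_null_sets) auto
    then show False by auto
  qed
  then obtain s where s: "\<And>N. s N > real N" "\<And>N. AE x in lborel. gpot \<mu> (s N) x = gpot \<nu> (s N) x" by metis
  have spos: "s n > 0" for n using s(1)[of n] by (meson le_less_trans of_nat_0_le_iff)
  \<comment> \<open>The width of the Gaussian, matching the parametrisation s = 1 / c^2 of
    \<open>gpot_mollify_tendsto\<close>.\<close>
  define c where "c n = 1 / sqrt (s n)" for n
  have c: "c n > 0" "1 / (c n)\<^sup>2 = s n" for n using spos[of n] by (auto simp: c_def power_divide)
  have "filterlim s at_top sequentially"
    by (rule filterlim_at_top_mono[OF filterlim_real_sequentially]) (simp add: s(1) less_imp_le)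
  then have "c \<longlonglongrightarrow> 0"
    unfolding c_def by (intro tendsto_divide_0[OF tendsto_const] filterlim_at_top_imp_at_infinity
        filterlim_compose[OF sqrt_at_top])
  show ?thesis
  proof (rule finite_measure_eqI_continuous[OF mu(1) mu.finite_measure_axioms nu(1) nu.finite_measure_axioms])
    fix f :: "complex \<Rightarrow> real"
    assume f: "continuous_on UNIV f" "\<And>x. 0 \<le> f x" "\<And>x. f x \<le> 1"
    let ?I = "\<lambda>\<mu> n. \<integral>\<^sup>+x. ennreal (f x) * ennreal (2 / (pi * (c n)\<^sup>2)) * ennreal (gpot \<mu> (1 / (c n)\<^sup>2) x) \<partial>lborel"
    have "?I \<mu> n = ?I \<nu> n" for n
      by (rule nn_integral_cong_AE, use s(2)[of n] in eventually_elim) (simp add: c(2))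
    then show "(\<integral>\<^sup>+x. ennreal (f x) \<partial>\<mu>) = (\<integral>\<^sup>+x. ennreal (f x) \<partial>\<nu>)"
      using gpot_mollify_tendsto[OF mu(1,2) f c(1) \<open>c \<longlonglongrightarrow> 0\<close>]
        gpot_mollify_tendsto[OF nu(1,2) f c(1) \<open>c \<longlonglongrightarrow> 0\<close>] by (simp add: LIMSEQ_unique)
  qed
qed

section \<open>Potentials, polar sets and masses\<close>

text \<open>The complement of the support is a union of null balls, and by Lindelof countably many
  of them cover it.\<close>

lemma AE_msupp:
  assumes "sets \<mu> = sets borel" shows "AE z in \<mu>. z \<in> msupp \<mu>"
proof -
  define F where "F = {S. \<exists>z e. S = ball z e \<and> e > 0 \<and> emeasure \<mu> (ball z e) = 0}"
  obtain F' where F': "F' \<subseteq> F" "countable F'" "\<Union> F' = \<Union> F"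
    by (rule Lindelof[of F]) (auto simp: F_def)
  have "\<Union> F' \<in> null_sets \<mu>"
    using F'(1) by (intro null_sets_UN'[OF F'(2), of id, simplified]) (auto simp: F_def null_sets_def assms)
  then have "AE z in \<mu>. z \<notin> \<Union> F'" by (rule AE_not_in)
  then show ?thesis
  proof eventually_elim
    case (elim z)
    show ?case unfolding msupp_def
    proof (safe)
      fix e :: real assume "e > 0" "emeasure \<mu> (ball z e) = 0"
      then have "ball z e \<in> F" by (auto simp: F_def)
      then show False using elim F'(3) \<open>e > 0\<close> by auto
    qed
  qed
qed

lemma closed_msupp:
  assumes "sets \<mu> = sets borel" shows "closed (msupp \<mu>)"
proof -
  have "open (- msupp \<mu>)"
  proof (subst open_contains_ball, safe)
    fix z assume "z \<notin> msupp \<mu>"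
    then obtain e where e: "e > 0" "emeasure \<mu> (ball z e) = 0" by (auto simp: msupp_def)
    have "w \<notin> msupp \<mu>" if w: "w \<in> ball z e" for w
    proof -
      obtain d where d: "d > 0" "ball w d \<subseteq> ball z e" using openE[OF open_ball w] by metis
      have "emeasure \<mu> (ball w d) \<le> emeasure \<mu> (ball z e)"
        using d assms by (intro emeasure_mono) auto
      then show ?thesis using d e by (auto simp: msupp_def)
    qed
    then show "\<exists>e>0. ball z e \<subseteq> - msupp \<mu>" using e by blast
  qed
  then show ?thesis by (simp add: closed_def)
qed

lemma msupp_subset_closed:
  assumes "closed K" "emeasure \<mu> (- K) = 0" "sets \<mu> = sets borel"
  shows "msupp \<mu> \<subseteq> K"
proof
  fix z assume z: "z \<in> msupp \<mu>"
  show "z \<in> K"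
  proof (rule ccontr)
    assume "z \<notin> K"
    then obtain e where e: "e > 0" "ball z e \<subseteq> - K" using assms(1) by (metis ComplI openE open_Compl)
    then have "emeasure \<mu> (ball z e) \<le> emeasure \<mu> (- K)" using assms by (intro emeasure_mono) auto
    then show False using z e assms(2) by (auto simp: msupp_def)
  qed
qed

section \<open>The two parts of the logarithm against the shifted kernel\<close>

lemma lkpos_measurable[measurable (raw)]:
  assumes [measurable]: "f \<in> borel_measurable N" "g \<in> borel_measurable N"
  shows "(\<lambda>x. lkpos (f x) (g x)) \<in> borel_measurable N"
  unfolding lkpos_def by measurable

lemma lkneg_measurable[measurable (raw)]:
  assumes [measurable]: "f \<in> borel_measurable N" "g \<in> borel_measurable N"
  shows "(\<lambda>x. lkneg (f x) (g x)) \<in> borel_measurable N"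
  unfolding lkneg_def by measurable

text \<open>After a translation the positive part is \<open>lker 1 0\<close> on the unit disk, so
  the value is the disk potential at the centre. Independence of z gives area measures of bounded
  sets finite energy.\<close>

lemma nn_integral_lkpos_lborel: "(\<integral>\<^sup>+w. lkpos z w \<partial>lborel) = ennreal (pi / 2)"
proof -
  have "lkpos z (z + u) = lker 1 0 u * indicator (cball 0 1) u" for u
    by (cases "u = 0") (auto simp: lkpos_def lker_def ln_div max_def split: split_indicator)
  moreover have "(\<integral>\<^sup>+w. lkpos z w \<partial>lborel) = (\<integral>\<^sup>+w. lkpos z w \<partial>distr lborel borel ((+) z))"
    by (simp add: lborel_distr_plus)
  ultimately have "(\<integral>\<^sup>+w. lkpos z w \<partial>lborel) = (\<integral>\<^sup>+u. lker 1 0 u * indicator (cball 0 1) u \<partial>lborel)"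
    by (simp add: nn_integral_distr)
  then show ?thesis by (simp add: disc_potential)
qed

text \<open>The decomposition of the logarithm into positive and negative part, written additively
  to avoid differences of infinities; on the diagonal both sides are infinite.\<close>

lemma lker_add_lkneg:
  assumes "z \<in> cball 0 L" "w \<in> cball 0 L" "L \<ge> 1"
  shows "lker (2 * L) z w + lkneg z w = lkpos z w + ennreal (ln (2 * L))"
proof (cases "z = w")
  case False
  have d: "0 < cmod (z - w)" "cmod (z - w) \<le> 2 * L"
    using False cmod_diff_le[OF assms(1,2)] by auto
  then have "ln (cmod (z - w)) \<le> ln (2 * L)" using assms(3) by (subst ln_le_cancel_iff) auto
  moreover have "0 \<le> ln (2 * L)" using assms by simp
  ultimately show ?thesis
    using False d assms by (simp add: lker_def lkneg_def lkpos_def ln_div max_def flip: ennreal_plus)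
qed (simp add: lker_def lkneg_def lkpos_def)

text \<open>Only b and c have to be finite: a and p may be infinite, and then are so together, as
  happens for measures of infinite energy.\<close>

lemma enn2ereal_diff_eq:
  assumes "a + b = p + c" "b < \<infinity>" "c < \<infinity>"
  shows "enn2ereal p - enn2ereal b = enn2ereal a - enn2ereal c"
proof -
  obtain b' c' where "b = ennreal b'" "b' \<ge> 0" "c = ennreal c'" "c' \<ge> 0"
    using assms by (cases b; cases c) auto
  moreover then have "enn2ereal a + ereal b' = enn2ereal p + ereal c'"
    using assms(1) by (metis enn2ereal_ennreal plus_ennreal.rep_eq)
  ultimately show ?thesis
    by (cases "enn2ereal a"; cases "enn2ereal p") auto
qed

lemma nn_integral_lker_add_lkneg:
  assumes "sets \<mu> = sets borel" "AE w in \<mu>. w \<in> cball 0 L" "L \<ge> 1" "z \<in> cball 0 L"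
  shows "(\<integral>\<^sup>+w. lker (2 * L) z w \<partial>\<mu>) + (\<integral>\<^sup>+w. lkneg z w \<partial>\<mu>) =
    (\<integral>\<^sup>+w. lkpos z w \<partial>\<mu>) + ennreal (ln (2 * L)) * emeasure \<mu> UNIV"
proof -
  note [measurable_cong] = assms(1)
  have sp: "space \<mu> = UNIV" using sets_eq_imp_space_eq[OF assms(1)] by simp
  have "(\<integral>\<^sup>+w. lker (2 * L) z w \<partial>\<mu>) + (\<integral>\<^sup>+w. lkneg z w \<partial>\<mu>) = (\<integral>\<^sup>+w. lker (2 * L) z w + lkneg z w \<partial>\<mu>)"
    by (subst nn_integral_add) measurable
  also have "\<dots> = (\<integral>\<^sup>+w. lkpos z w + ennreal (ln (2 * L)) \<partial>\<mu>)"
    by (rule nn_integral_cong_AE, use assms(2) in eventually_elim) (use assms lker_add_lkneg in auto)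
  also have "\<dots> = (\<integral>\<^sup>+w. lkpos z w \<partial>\<mu>) + ennreal (ln (2 * L)) * emeasure \<mu> UNIV"
    by (subst nn_integral_add, measurable) (simp add: sp)
  finally show ?thesis .
qed

lemma lkneg_le:
  assumes "z \<in> cball 0 L" "w \<in> cball 0 L" "L \<ge> 1"
  shows "lkneg z w \<le> ennreal (ln (2 * L))"
proof (cases "z = w")
  case False
  have "0 < cmod (z - w)" "cmod (z - w) \<le> 2 * L"
    using False cmod_diff_le[OF assms(1,2)] by auto
  then have "ln (cmod (z - w)) \<le> ln (2 * L)" using assms(3) by (subst ln_le_cancel_iff) auto
  moreover have "0 \<le> ln (2 * L)" using assms by simp
  ultimately show ?thesis by (simp add: lkneg_def ennreal_leI)
qed (simp add: lkneg_def)

lemma nn_integral_lkneg_le: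
  assumes "sets \<mu> = sets borel" "AE w in \<mu>. w \<in> cball 0 L" "L \<ge> 1" "z \<in> cball 0 L"
  shows "(\<integral>\<^sup>+w. lkneg z w \<partial>\<mu>) \<le> ennreal (ln (2 * L)) * emeasure \<mu> UNIV"
proof -
  have sp: "space \<mu> = UNIV" using sets_eq_imp_space_eq[OF assms(1)] by simp
  have "(\<integral>\<^sup>+w. lkneg z w \<partial>\<mu>) \<le> (\<integral>\<^sup>+w. ennreal (ln (2 * L)) \<partial>\<mu>)"
    by (rule nn_integral_mono_AE, use assms(2) in eventually_elim) (use assms lkneg_le in auto)
  then show ?thesis by (simp add: sp)
qed

lemma log_pot_eq:
  assumes "sets \<mu> = sets borel" "finite_measure \<mu>" "AE w in \<mu>. w \<in> cball 0 L" "L \<ge> 1" "z \<in> cball 0 L"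
  shows "log_pot \<mu> z = enn2ereal (\<integral>\<^sup>+w. lker (2 * L) z w \<partial>\<mu>) - enn2ereal (ennreal (ln (2 * L)) * emeasure \<mu> UNIV)"
proof -
  have fin: "emeasure \<mu> UNIV < \<infinity>"
    using finite_measure.emeasure_finite[OF assms(2), of UNIV] by (simp add: top.not_eq_extremum)
  then have c: "ennreal (ln (2 * L)) * emeasure \<mu> UNIV < \<infinity>" by (simp add: ennreal_mult_less_top)
  show ?thesis unfolding log_pot_def
    by (rule enn2ereal_diff_eq[OF nn_integral_lker_add_lkneg[OF assms(1,3,4,5)] _ c])
       (use nn_integral_lkneg_le[OF assms(1,3,4,5)] c in \<open>auto intro: le_less_trans\<close>)
qed

lemma log_energy_eq:
  assumes "sets \<mu> = sets borel" "prob_space \<mu>" "AE w in \<mu>. w \<in> cball 0 L" "L \<ge> 1"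
  shows "log_energy \<mu> = enn2ereal (lenergy (2 * L) \<mu> \<mu>) - ereal (ln (2 * L))"
proof -
  interpret prob_space \<mu> by fact
  note [measurable_cong] = assms(1)
  have sp: "space \<mu> = UNIV" using sets_eq_imp_space_eq[OF assms(1)] by simp
  then have e1: "emeasure \<mu> UNIV = 1" using emeasure_space_1 by simp
  have "lenergy (2 * L) \<mu> \<mu> + (\<integral>\<^sup>+z. (\<integral>\<^sup>+w. lkneg z w \<partial>\<mu>) \<partial>\<mu>) =
     (\<integral>\<^sup>+z. (\<integral>\<^sup>+w. lker (2 * L) z w \<partial>\<mu>) + (\<integral>\<^sup>+w. lkneg z w \<partial>\<mu>) \<partial>\<mu>)"
    unfolding lenergy_def by (subst nn_integral_add) measurable
  also have "\<dots> = (\<integral>\<^sup>+z. (\<integral>\<^sup>+w. lkpos z w \<partial>\<mu>) + ennreal (ln (2 * L)) * 1 \<partial>\<mu>)"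
    by (rule nn_integral_cong_AE, use assms(3) in eventually_elim)
       (use nn_integral_lker_add_lkneg[OF assms(1,3,4)] e1 in simp)
  also have "\<dots> = (\<integral>\<^sup>+z. (\<integral>\<^sup>+w. lkpos z w \<partial>\<mu>) \<partial>\<mu>) + ennreal (ln (2 * L))"
    by (subst nn_integral_add, measurable) (simp add: sp e1)
  finally have eq: "lenergy (2 * L) \<mu> \<mu> + (\<integral>\<^sup>+z. (\<integral>\<^sup>+w. lkneg z w \<partial>\<mu>) \<partial>\<mu>) =
     (\<integral>\<^sup>+z. (\<integral>\<^sup>+w. lkpos z w \<partial>\<mu>) \<partial>\<mu>) + ennreal (ln (2 * L))" .
  have "(\<integral>\<^sup>+z. (\<integral>\<^sup>+w. lkneg z w \<partial>\<mu>) \<partial>\<mu>) \<le> (\<integral>\<^sup>+z. ennreal (ln (2 * L)) \<partial>\<mu>)"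
    by (rule nn_integral_mono_AE, use assms(3) in eventually_elim)
       (use nn_integral_lkneg_le[OF assms(1,3,4)] e1 in simp)
  also have "\<dots> < \<infinity>" by (simp add: sp e1)
  finally have "log_energy \<mu> = enn2ereal (lenergy (2 * L) \<mu> \<mu>) - enn2ereal (ennreal (ln (2 * L)))"
    unfolding log_energy_def by (intro enn2ereal_diff_eq[OF eq]) auto
  then show ?thesis using assms(4) by (simp add: enn2ereal_ennreal)
qed

text \<open>If nu charged B, inner regularity would give a compact K inside B of positive mass. The
  normalised restriction of nu to K is a test measure in the definition of \<open>polar\<close>, yet
  the positive part of its energy is at most that of nu divided by nu(K)^2.\<close>

lemma polar_null_finite_energy:
  assumes nu: "sets \<nu> = sets borel" "finite_measure \<nu>"
    and fin: "(\<integral>\<^sup>+z. (\<integral>\<^sup>+w. lkpos z w \<partial>\<nu>) \<partial>\<nu>) < \<infinity>" and "polar B"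
  shows "emeasure \<nu> B = 0"
proof (rule ccontr)
  interpret finite_measure \<nu> by fact
  note [measurable_cong] = nu(1)
  assume "emeasure \<nu> B \<noteq> 0"
  then have "0 < emeasure \<nu> B" by (simp add: zero_less_iff_neq_zero)
  moreover have B: "B \<in> sets borel" using \<open>polar B\<close> by (simp add: polar_def)
  ultimately have "0 < (SUP K \<in> {K. K \<subseteq> B \<and> compact K}. emeasure \<nu> K)"
    using inner_regular[OF nu(1) _ B] emeasure_finite by auto
  then obtain K where K: "K \<subseteq> B" "compact K" "0 < emeasure \<nu> K"
    by (auto simp: less_SUP_iff)
  have [measurable]: "K \<in> sets borel" using K(2) by (simp add: borel_compact)
  have Kn: "emeasure \<nu> K \<noteq> 0" "emeasure \<nu> K \<noteq> \<infinity>" using K(3) emeasure_finite by auto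
  let ?\<mu> = "uniform_measure \<nu> K"
  have s: "sets ?\<mu> = sets borel" using nu by (simp add: uniform_measure_def)
  note [measurable_cong] = s
  have "emeasure ?\<mu> (- K) = 0" using nu by (subst emeasure_uniform_measure) auto
  then have ms: "msupp ?\<mu> \<subseteq> K" using K(2) s by (intro msupp_subset_closed) (auto intro: compact_imp_closed)
  have "prob_on B ?\<mu>"
    unfolding prob_on_def
  proof (intro conjI s)
    show "prob_space ?\<mu>" using Kn by (intro prob_space_uniform_measure) auto
    show "compact (msupp ?\<mu>)"
      using K(2) ms closed_msupp[OF s] compact_Int_closed by (metis inf.absorb2)
    show "msupp ?\<mu> \<subseteq> B" using ms K(1) by blast
  qed
  then have inf: "log_energy ?\<mu> = \<infinity>" using \<open>polar B\<close> by (simp add: polar_def)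
  have le: "(\<integral>\<^sup>+z. f z \<partial>?\<mu>) \<le> (\<integral>\<^sup>+z. f z \<partial>\<nu>) / emeasure \<nu> K" if [measurable]: "f \<in> borel_measurable borel" for f
  proof -
    have "(\<integral>\<^sup>+z. f z \<partial>?\<mu>) = (\<integral>\<^sup>+z. f z * indicator K z \<partial>\<nu>) / emeasure \<nu> K"
      using Kn by (intro nn_integral_uniform_measure) measurable
    also have "\<dots> \<le> (\<integral>\<^sup>+z. f z \<partial>\<nu>) / emeasure \<nu> K"
      by (intro divide_right_mono_ennreal nn_integral_mono) (auto split: split_indicator)
    finally show ?thesis .
  qed
  have "(\<integral>\<^sup>+z. (\<integral>\<^sup>+w. lkpos z w \<partial>?\<mu>) \<partial>?\<mu>) \<le> (\<integral>\<^sup>+z. (\<integral>\<^sup>+w. lkpos z w \<partial>\<nu>) / emeasure \<nu> K \<partial>?\<mu>)"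
    by (intro nn_integral_mono le) measurable
  also have "\<dots> \<le> (\<integral>\<^sup>+z. (\<integral>\<^sup>+w. lkpos z w \<partial>\<nu>) / emeasure \<nu> K \<partial>\<nu>) / emeasure \<nu> K"
    by (intro le) measurable
  also have "\<dots> = (\<integral>\<^sup>+z. (\<integral>\<^sup>+w. lkpos z w \<partial>\<nu>) \<partial>\<nu>) / emeasure \<nu> K / emeasure \<nu> K"
    by (subst nn_integral_divide) auto
  also have "\<dots> < \<infinity>" using fin Kn by (auto simp: ennreal_divide_eq_top_iff top.not_eq_extremum[symmetric])
  finally have "(\<integral>\<^sup>+z. (\<integral>\<^sup>+w. lkpos z w \<partial>?\<mu>) \<partial>?\<mu>) < \<infinity>" .
  then have "enn2ereal (\<integral>\<^sup>+z. (\<integral>\<^sup>+w. lkpos z w \<partial>?\<mu>) \<partial>?\<mu>) \<noteq> \<infinity>"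
    by (metis enn2ereal_eq_top_iff infinity_ennreal_def less_irrefl top_ereal_def)
  then have "log_energy ?\<mu> \<noteq> \<infinity>"
    unfolding log_energy_def using enn2ereal_nonneg
    by (metis ereal_minus_eq_PInfty_iff enn2ereal_nonneg ereal_infty_less_eq2(2) MInfty_neq_PInfty(1) not_MInfty_nonneg)
  then show False using inf by simp
qed

section \<open>Normalised area measures and sums of measures\<close>

lemma sets_area_meas [simp, measurable_cong]: "sets (area_meas A) = sets borel"
  by (simp add: area_meas_def)

lemma nn_integral_area_meas:
  assumes [measurable]: "A \<in> sets borel" "f \<in> borel_measurable borel"
  shows "(\<integral>\<^sup>+w. f w \<partial>area_meas A) = ennreal (1 / pi) * (\<integral>\<^sup>+w. f w * indicator A w \<partial>lborel)"
  unfolding area_meas_def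
  by (simp add: nn_integral_density mult.assoc nn_integral_cmult) (simp add: mult.commute)

lemma emeasure_area_meas:
  assumes [measurable]: "A \<in> sets borel" "X \<in> sets borel"
  shows "emeasure (area_meas A) X = ennreal (1 / pi) * emeasure lborel (A \<inter> X)"
proof -
  have "emeasure (area_meas A) X = (\<integral>\<^sup>+w. indicator X w \<partial>area_meas A)" by simp
  also have "\<dots> = ennreal (1 / pi) * (\<integral>\<^sup>+w. indicator X w * indicator A w \<partial>lborel)"
    by (rule nn_integral_area_meas) measurable
  also have "(\<integral>\<^sup>+w. indicator X w * indicator A w \<partial>lborel) = (\<integral>\<^sup>+w. indicator (A \<inter> X) w \<partial>lborel)"
    by (intro nn_integral_cong) (auto split: split_indicator)
  finally show ?thesis by simp
qed

lemma finite_measure_area_meas: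
  assumes "A \<in> sets borel" "bounded A"
  shows "finite_measure (area_meas A)"
proof
  have "emeasure lborel A < \<infinity>" using assms(2) by (rule emeasure_bounded_finite)
  then show "emeasure (area_meas A) (space (area_meas A)) \<noteq> \<infinity>"
    using assms(1) by (simp add: area_meas_def emeasure_density nn_integral_cmult ennreal_mult_eq_top_iff)
qed

lemma nn_integral_lkpos_area_meas_le:
  assumes [measurable]: "A \<in> sets borel"
  shows "(\<integral>\<^sup>+w. lkpos z w \<partial>area_meas A) \<le> ennreal (1 / 2)"
proof -
  have "(\<integral>\<^sup>+w. lkpos z w \<partial>area_meas A) \<le> ennreal (1 / pi) * (\<integral>\<^sup>+w. lkpos z w \<partial>lborel)"
    by (subst nn_integral_area_meas) (auto intro!: mult_left_mono nn_integral_mono split: split_indicator)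
  also have "\<dots> = ennreal (1 / 2)"
    unfolding nn_integral_lkpos_lborel by (subst ennreal_mult[symmetric]) auto
  finally show ?thesis .
qed

text \<open>On each disk the positive part of the potential of normalised area is at most 1/2, so
  its energy is finite and it charges no polar set; disks exhaust the plane.\<close>

lemma polar_null_area:
  assumes "polar B" shows "B \<in> null_sets lborel"
proof -
  have B[measurable]: "B \<in> sets borel" using assms by (simp add: polar_def)
  have "cball 0 (real n) \<inter> B \<in> null_sets lborel" for n
  proof -
    let ?A = "area_meas (cball 0 (real n))"
    interpret finite_measure ?A by (rule finite_measure_area_meas) auto
    have "(\<integral>\<^sup>+z. (\<integral>\<^sup>+w. lkpos z w \<partial>?A) \<partial>?A) \<le> (\<integral>\<^sup>+z. ennreal (1 / 2) \<partial>?A)"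
      by (intro nn_integral_mono nn_integral_lkpos_area_meas_le) auto
    also have "\<dots> < \<infinity>"
      using emeasure_finite[of "space ?A"] by (simp add: less_top[symmetric] ennreal_mult_eq_top_iff)
    finally have "emeasure ?A B = 0"
      using assms by (intro polar_null_finite_energy) (auto simp: finite_measure_axioms)
    then have "emeasure lborel (cball 0 (real n) \<inter> B) = 0"
      by (subst (asm) emeasure_area_meas) auto
    then show ?thesis by (auto simp: null_sets_def)
  qed
  then have "(\<Union>n. cball 0 (real n) \<inter> B) \<in> null_sets lborel" by (intro null_sets_UN)
  moreover have "(\<Union>n. cball 0 (real n) \<inter> B) = B" by (auto simp: real_arch_simple)
  ultimately show ?thesis by simp
qed

lemma AE_area_meas_not_polar:
  assumes "polar B" and [measurable]: "A \<in> sets borel"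
  shows "AE z in area_meas A. z \<notin> B"
  using AE_not_in[OF polar_null_area[OF assms(1)]] unfolding area_meas_def
  by (subst AE_density) auto

lemma sets_add_meas [simp, measurable_cong]: "sets (add_meas \<mu> \<nu>) = sets borel"
  using sets.sigma_sets_eq[of "borel :: complex measure"] by (simp add: add_meas_def)

lemma space_add_meas [simp]: "space (add_meas \<mu> \<nu>) = UNIV"
  by (simp add: add_meas_def)

lemma emeasure_add_meas:
  assumes "sets \<mu> = sets borel" "sets \<nu> = sets borel" "A \<in> sets borel"
  shows "emeasure (add_meas \<mu> \<nu>) A = emeasure \<mu> A + emeasure \<nu> A"
proof (rule emeasure_measure_of[OF add_meas_def])
  show "countably_additive (sets (add_meas \<mu> \<nu>)) (\<lambda>A. emeasure \<mu> A + emeasure \<nu> A)"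
    using assms(1,2) by (auto simp: countably_additive_def suminf_add[symmetric] suminf_emeasure)
qed (use assms in \<open>auto simp: positive_def\<close>)

lemma nn_integral_add_meas:
  assumes mu: "sets \<mu> = sets borel" and nu: "sets \<nu> = sets borel" and "f \<in> borel_measurable borel"
  shows "(\<integral>\<^sup>+x. f x \<partial>add_meas \<mu> \<nu>) = (\<integral>\<^sup>+x. f x \<partial>\<mu>) + (\<integral>\<^sup>+x. f x \<partial>\<nu>)"
  using assms(3)
proof (induction rule: borel_measurable_induct)
  case (cong f g)
  then show ?case by (simp add: fun_eq_iff)
next
  case (set A)
  then show ?case using mu nu by (simp add: emeasure_add_meas)
next
  case (mult u c)
  note [measurable_cong] = mu nu
  from mult show ?case by (simp add: nn_integral_cmult distrib_left)
next
  case (add u v)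
  note [measurable_cong] = mu nu
  from add show ?case by (simp add: nn_integral_add ac_simps)
next
  case (seq U)
  note [measurable_cong] = mu nu
  have [measurable]: "U i \<in> borel_measurable borel" for i by (rule seq)
  have inc: "incseq (\<lambda>i. \<integral>\<^sup>+x. U i x \<partial>M)" for M :: "complex measure"
    using seq(3) by (auto simp: incseq_def le_fun_def intro!: nn_integral_mono)
  have sup: "(\<integral>\<^sup>+x. Sup (range U) x \<partial>M) = (SUP i. \<integral>\<^sup>+x. U i x \<partial>M)" if [measurable_cong]: "sets M = sets borel" for M
    unfolding SUP_apply by (rule nn_integral_monotone_convergence_SUP[OF seq(3)]) measurable
  show ?case
    unfolding sup[OF mu] sup[OF nu] sup[OF sets_add_meas] seq.IH
    by (rule ennreal_SUP_add[OF inc inc])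
qed

lemma AE_add_meas:
  assumes mu: "sets \<mu> = sets borel" and nu: "sets \<nu> = sets borel" and [measurable]: "{x. P x} \<in> sets borel"
    and "AE x in \<mu>. P x" "AE x in \<nu>. P x"
  shows "AE x in add_meas \<mu> \<nu>. P x"
proof -
  have sp: "space \<mu> = UNIV" "space \<nu> = UNIV"
    using sets_eq_imp_space_eq[OF mu] sets_eq_imp_space_eq[OF nu] by simp_all
  have S: "- {x. P x} \<in> sets borel" by measurable
  have "emeasure \<mu> (- {x. P x}) = 0" "emeasure \<nu> (- {x. P x}) = 0"
    using assms(4,5) S by (auto simp: AE_iff_null sp mu nu Compl_eq null_sets_def)
  then have "emeasure (add_meas \<mu> \<nu>) (- {x. P x}) = 0"
    using emeasure_add_meas[OF mu nu S] by simp
  then show ?thesis using S by (intro AE_I[of _ _ "- {x. P x}"]) auto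
qed

text \<open>The distance from z to a point of the unit disk lies between |z| - 1 >= 1 and |z| + 1.
  Hence the positive part of the kernel vanishes and the potential is comparable to -log |z| times
  the mass.\<close>

lemma log_pot_far:
  assumes mu: "sets \<mu> = sets borel" "AE w in \<mu>. w \<in> cball 0 1" and z: "cmod z \<ge> 2"
  shows "log_pot \<mu> z = - enn2ereal (\<integral>\<^sup>+w. lkneg z w \<partial>\<mu>)"
    "ennreal (ln (cmod z - 1)) * emeasure \<mu> UNIV \<le> (\<integral>\<^sup>+w. lkneg z w \<partial>\<mu>)"
    "(\<integral>\<^sup>+w. lkneg z w \<partial>\<mu>) \<le> ennreal (ln (cmod z + 1)) * emeasure \<mu> UNIV"
proof -
  have sp: "space \<mu> = UNIV" using sets_eq_imp_space_eq[OF mu(1)] by simp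
  have d: "cmod z - 1 \<le> cmod (z - w)" "cmod (z - w) \<le> cmod z + 1" if "w \<in> cball 0 1" for w
    using that norm_triangle_ineq4[of z w] norm_triangle_ineq2[of z w] by auto
  have "(\<integral>\<^sup>+w. lkpos z w \<partial>\<mu>) = (\<integral>\<^sup>+w. 0 \<partial>\<mu>)"
  proof (rule nn_integral_cong_AE, use mu(2) in eventually_elim)
    case (elim w)
    then have "1 \<le> cmod (z - w)" using d(1)[OF elim] z by linarith
    then show ?case by (auto simp: lkpos_def)
  qed
  then show "log_pot \<mu> z = - enn2ereal (\<integral>\<^sup>+w. lkneg z w \<partial>\<mu>)"
    by (simp add: log_pot_def zero_ennreal.rep_eq)
  have b: "ennreal (ln (cmod z - 1)) \<le> lkneg z w \<and> lkneg z w \<le> ennreal (ln (cmod z + 1))"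
    if w: "w \<in> cball 0 1" for w
  proof -
    have "ln (cmod z - 1) \<le> ln (cmod (z - w))" "ln (cmod (z - w)) \<le> ln (cmod z + 1)" "0 \<le> ln (cmod z + 1)"
      using d[OF w] z by (auto intro!: ln_mono ln_ge_zero)
    then show ?thesis by (auto simp: lkneg_def intro!: ennreal_leI)
  qed
  have "(\<integral>\<^sup>+w. ennreal (ln (cmod z - 1)) \<partial>\<mu>) \<le> (\<integral>\<^sup>+w. lkneg z w \<partial>\<mu>)"
    by (rule nn_integral_mono_AE, use mu(2) in eventually_elim) (use b in blast)
  then show "ennreal (ln (cmod z - 1)) * emeasure \<mu> UNIV \<le> (\<integral>\<^sup>+w. lkneg z w \<partial>\<mu>)"
    by (simp add: sp)
  have "(\<integral>\<^sup>+w. lkneg z w \<partial>\<mu>) \<le> (\<integral>\<^sup>+w. ennreal (ln (cmod z + 1)) \<partial>\<mu>)"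
    by (rule nn_integral_mono_AE, use mu(2) in eventually_elim) (use b in blast)
  then show "(\<integral>\<^sup>+w. lkneg z w \<partial>\<mu>) \<le> ennreal (ln (cmod z + 1)) * emeasure \<mu> UNIV"
    by (simp add: sp)
qed

text \<open>The mass is the coefficient of -log |z| at infinity, because ln (r + 1) / ln (r - 1)
  tends to 1. Agreement at some points of arbitrarily large modulus suffices.\<close>

lemma mass_le_of_log_pot_eq:
  assumes mu: "sets \<mu> = sets borel" "finite_measure \<mu>" "AE w in \<mu>. w \<in> cball 0 1"
    and nu: "sets \<nu> = sets borel" "finite_measure \<nu>" "AE w in \<nu>. w \<in> cball 0 1"
    and eq: "\<And>R. \<exists>z. cmod z > R \<and> log_pot \<mu> z = log_pot \<nu> z"
  shows "emeasure \<mu> UNIV \<le> emeasure \<nu> UNIV"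
proof -
  interpret mu: finite_measure \<mu> by fact
  interpret nu: finite_measure \<nu> by fact
  define m where "m = measure \<mu> UNIV"
  define a where "a = measure \<nu> UNIV"
  have m: "emeasure \<mu> UNIV = ennreal m" and a: "emeasure \<nu> UNIV = ennreal a"
    by (simp_all add: m_def a_def mu.emeasure_eq_measure nu.emeasure_eq_measure)
  have "m \<le> a"
  proof (rule ccontr)
    assume "\<not> m \<le> a"
    then have am: "a < m" by simp
    have a0: "a \<ge> 0" "m \<ge> 0" by (simp_all add: a_def m_def)
    have "((\<lambda>r::real. a * (ln (r + 1) / ln (r - 1))) \<longlongrightarrow> a * 1) at_top"
      by (rule tendsto_mult[OF tendsto_const]) real_asymp
    then have "eventually (\<lambda>r. a * (ln (r + 1) / ln (r - 1)) < m) at_top"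
      using am by (auto dest: order_tendstoD(2))
    then obtain R where R: "\<And>r. r \<ge> R \<Longrightarrow> a * (ln (r + 1) / ln (r - 1)) < m"
      by (auto simp: eventually_at_top_linorder)
    obtain z where z: "cmod z > max R 2" "log_pot \<mu> z = log_pot \<nu> z" using eq by blast
    then have z2: "cmod z \<ge> 2" "cmod z > 2" by auto
    then have pos: "ln (cmod z - 1) > 0" by (intro ln_gt_zero) auto
    have "(\<integral>\<^sup>+w. lkneg z w \<partial>\<mu>) = (\<integral>\<^sup>+w. lkneg z w \<partial>\<nu>)"
      using z(2) log_pot_far(1)[OF mu(1,3) z2(1)] log_pot_far(1)[OF nu(1,3) z2(1)] by (simp add: enn2ereal_inject)
    then have "ennreal (ln (cmod z - 1)) * ennreal m \<le> ennreal (ln (cmod z + 1)) * ennreal a"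
      using log_pot_far(2)[OF mu(1,3) z2(1)] log_pot_far(3)[OF nu(1,3) z2(1)] m a by simp
    moreover have "ln (cmod z + 1) \<ge> 0" using z2 by (intro ln_ge_zero) auto
    ultimately have "ln (cmod z - 1) * m \<le> ln (cmod z + 1) * a"
      using pos a0 by (simp flip: ennreal_mult)
    moreover have "a * (ln (cmod z + 1) / ln (cmod z - 1)) < m" using z(1) by (intro R) simp
    ultimately show False using pos by (simp add: field_simps)
  qed
  then show ?thesis unfolding m a by (rule ennreal_leI)
qed

section \<open>The equilibrium measure\<close>

lemma lkpos_le_lker:
  assumes "z \<in> cball 0 L" "w \<in> cball 0 L" "L \<ge> 1"
  shows "lkpos z w \<le> lker (2 * L) z w"
proof (cases "z = w")
  case False
  have d: "0 < cmod (z - w)" "cmod (z - w) \<le> 2 * L"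
    using False cmod_diff_le[OF assms(1,2)] by auto
  then have "ln (cmod (z - w)) \<le> ln (2 * L)" using assms(3) by (subst ln_le_cancel_iff) auto
  moreover have "0 \<le> ln (2 * L)" using assms by simp
  moreover have "ln (2 * L / cmod (z - w)) = ln (2 * L) - ln (cmod (z - w))"
    using d assms by (auto simp: ln_div)
  ultimately show ?thesis using False by (auto simp: lker_def lkpos_def intro!: ennreal_leI)
qed (simp add: lker_def lkpos_def)

lemma AE_in_of_null_compl:
  assumes "sets \<mu> = sets borel" "emeasure \<mu> (- S) = 0" "S \<in> sets borel" shows "AE z in \<mu>. z \<in> S"
  by (rule AE_I[of _ _ "- S"]) (use assms in auto)

lemma AE_area_meas: "A \<in> sets borel \<Longrightarrow> AE z in area_meas A. z \<in> A"
  unfolding area_meas_def by (subst AE_density) (auto simp: indicator_def)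

text \<open>The potential of the area measure of the unit disk normalised to mass 1, raised by the
  shift ln (2L).\<close>

definition disc_pot :: "real \<Rightarrow> complex \<Rightarrow> real" where
  "disc_pot L z = (if cmod z \<le> 1 then ln (2 * L) + (1 - (cmod z)\<^sup>2) / 2 else ln (2 * L / cmod z))"

lemma disc_pot_measurable [measurable]: "disc_pot L \<in> borel_measurable borel"
  unfolding disc_pot_def by measurable

text \<open>Outside the disk this is ln x <= x - 1 at x = |z|^2; inside it is an equality.\<close>

lemma disc_pot_ge:
  assumes "L \<ge> 1" shows "disc_pot L z \<ge> ln (2 * L) + (1 - (cmod z)\<^sup>2) / 2"
proof (cases "cmod z \<le> 1")
  case False
  have "ln ((cmod z)\<^sup>2) \<le> (cmod z)\<^sup>2 - 1" using False by (intro ln_le_minus_one) auto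
  then have "2 * ln (cmod z) \<le> (cmod z)\<^sup>2 - 1" using False by (simp add: ln_realpow)
  then show ?thesis using False assms by (auto simp: disc_pot_def ln_div)
qed (simp add: disc_pot_def)

lemma disc_pot_nonneg:
  assumes "z \<in> cball 0 L" "L \<ge> 1" shows "disc_pot L z \<ge> 0"
  using assms by (auto simp: disc_pot_def le_divide_eq intro!: ln_ge_zero add_nonneg_nonneg power_le_one)

lemma disc_pot_le:
  assumes "L \<ge> 1" shows "disc_pot L z \<le> ln (2 * L) + 1 / 2"
proof (cases "cmod z \<le> 1")
  case False
  then have "0 \<le> ln (cmod z)" by (intro ln_ge_zero) auto
  moreover have "disc_pot L z = ln (2 * L) - ln (cmod z)" using False assms by (auto simp: disc_pot_def ln_div)
  ultimately show ?thesis by linarith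
qed (simp add: disc_pot_def)

definition second_moment :: "complex measure \<Rightarrow> real" where "second_moment \<mu> = (\<integral>z. (cmod z)\<^sup>2 \<partial>\<mu>)"

lemma integrable_cmod_sq:
  assumes "sets \<mu> = sets borel" "finite_measure \<mu>" "AE z in \<mu>. z \<in> cball 0 L"
  shows "integrable \<mu> (\<lambda>z. (cmod z)\<^sup>2)"
proof -
  interpret finite_measure \<mu> by fact
  note [measurable_cong] = assms(1)
  show ?thesis
  proof (rule integrable_const_bound[of _ "L\<^sup>2"])
    show "AE z in \<mu>. norm ((cmod z)\<^sup>2) \<le> L\<^sup>2"
      using assms(3) by eventually_elim (auto intro: power_mono)
  qed measurable
qed

text \<open>The exceptional set \<open>B\<close> is fixed once, so that q.e. equality becomes
  equality off one given polar set, which measures of finite energy do not charge.\<close>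

locale disc_balayage =
  fixes U :: "complex set" and \<nu>2 :: "complex measure" and B :: "complex set"
  assumes open_U: "open U" and U_disc: "U \<subseteq> ball 0 1"
    and sets_\<nu>2 [simp, measurable_cong]: "sets \<nu>2 = sets borel"
    and fin_\<nu>2: "finite_measure \<nu>2"
    and frontier_\<nu>2: "emeasure \<nu>2 (- frontier U) = 0"
    and polar_\<nu>2: "polar C \<Longrightarrow> emeasure \<nu>2 C = 0"
    and polar_B: "polar B"
    and log_pot_\<nu>2: "z \<in> - U - B \<Longrightarrow> log_pot \<nu>2 z = log_pot (area_meas U) z"
begin

abbreviation \<nu>1 :: "complex measure" where "\<nu>1 \<equiv> area_meas (cball 0 1 - U)"
abbreviation \<nu> :: "complex measure" where "\<nu> \<equiv> add_meas \<nu>1 \<nu>2"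

lemma borel_sets [measurable]: "U \<in> sets borel" "B \<in> sets borel" "cball 0 1 - U \<in> sets borel"
  using open_U polar_B by (auto simp: polar_def)

lemma frontier_subset: "frontier U \<subseteq> cball 0 1 - U"
proof -
  have "closure U \<subseteq> cball 0 1"
    using U_disc by (intro closure_minimal) (auto intro: less_imp_le simp: subset_iff)
  then show ?thesis using open_U by (auto simp: frontier_def interior_open)
qed

text \<open>nu2 is concentrated where its potential is known: on the frontier, which misses the open
  set U and lies in the closed disk, and off the polar set B.\<close>

lemma AE_\<nu>2: "AE z in \<nu>2. z \<in> cball 0 1 - U - B"
proof -
  have "AE z in \<nu>2. z \<in> frontier U"
    by (rule AE_in_of_null_compl) (auto simp: frontier_\<nu>2 intro: borel_closed)
  moreover have "AE z in \<nu>2. z \<in> - B"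
    by (rule AE_in_of_null_compl) (auto simp: polar_\<nu>2[OF polar_B])
  ultimately show ?thesis by eventually_elim (use frontier_subset in auto)
qed

lemma AE_\<nu>1: "AE z in \<nu>1. z \<in> cball 0 1 - U - B"
proof -
  have "AE z in \<nu>1. z \<in> cball 0 1 - U" by (rule AE_area_meas) measurable
  moreover have "AE z in \<nu>1. z \<notin> B" by (rule AE_area_meas_not_polar[OF polar_B]) measurable
  ultimately show ?thesis by eventually_elim auto
qed

lemma AE_\<nu>: "AE z in \<nu>. z \<in> cball 0 1 - U - B"
  by (rule AE_add_meas[OF _ _ _ AE_\<nu>1 AE_\<nu>2]) auto

lemma AE_area_U: "AE z in area_meas U. z \<in> cball 0 1"
  using AE_area_meas[OF borel_sets(1)] by eventually_elim (use U_disc in \<open>auto intro: less_imp_le simp: subset_iff\<close>)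

lemma fin_area_U: "finite_measure (area_meas U)"
  using U_disc by (intro finite_measure_area_meas bounded_subset[OF bounded_ball]) auto

lemma mass_\<nu>2: "emeasure \<nu>2 UNIV = emeasure (area_meas U) UNIV"
proof -
  have far: "\<exists>z. cmod z > R \<and> log_pot \<nu>2 z = log_pot (area_meas U) z" for R
  proof -
    \<comment> \<open>The centre |R| + 2 puts this disk beyond modulus |R| + 1, hence outside U and
      beyond R; having positive area, it is not contained in the polar set B.\<close>
    let ?D = "ball (of_real (\<bar>R\<bar> + 2)) 1 :: complex set"
    have "\<not> ?D \<subseteq> B"
    proof
      assume "?D \<subseteq> B"
      then have "?D \<in> null_sets lborel"
        by (intro null_sets_subset[OF polar_null_area[OF polar_B]]) auto
      then show False by (auto simp: null_sets_def emeasure_ball unit_ball_vol_2)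
    qed
    then obtain z where z: "z \<in> ?D" "z \<notin> B" by blast
    then have "cmod z > \<bar>R\<bar> + 1"
      using norm_triangle_ineq2[of "of_real (\<bar>R\<bar> + 2)" z] by (simp add: dist_norm)
    moreover then have "z \<notin> U" using U_disc by (auto simp: subset_iff)
    ultimately show ?thesis using log_pot_\<nu>2[of z] z by (intro exI[of _ z]) auto
  qed
  have "AE z in \<nu>2. z \<in> cball 0 1" using AE_\<nu>2 by eventually_elim auto
  moreover have "\<exists>z. cmod z > R \<and> log_pot (area_meas U) z = log_pot \<nu>2 z" for R
    using far[of R] by metis
  ultimately show ?thesis
    using far by (intro antisym mass_le_of_log_pot_eq fin_\<nu>2 fin_area_U AE_area_U) auto
qed

lemma nn_integral_disc_split:
  assumes [measurable]: "f \<in> borel_measurable borel"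
  shows "(\<integral>\<^sup>+w. f w \<partial>\<nu>1) + (\<integral>\<^sup>+w. f w \<partial>area_meas U) =
    ennreal (1 / pi) * (\<integral>\<^sup>+w. f w * indicator (cball 0 1) w \<partial>lborel)"
proof -
  have "f w * indicator (cball 0 1) w = f w * indicator (cball 0 1 - U) w + f w * indicator U w" for w
    using U_disc by (auto split: split_indicator)
  then show ?thesis
    by (simp add: nn_integral_area_meas nn_integral_add distrib_left)
qed

lemma emeasure_\<nu>: "emeasure \<nu> UNIV = 1"
proof -
  have "emeasure \<nu> UNIV = emeasure \<nu>1 UNIV + emeasure (area_meas U) UNIV"
    by (simp add: emeasure_add_meas mass_\<nu>2)
  also have "\<dots> = (\<integral>\<^sup>+w. indicator UNIV w \<partial>\<nu>1) + (\<integral>\<^sup>+w. indicator UNIV w \<partial>area_meas U)"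
    by (subst (1 2) nn_integral_indicator) auto
  also have "\<dots> = ennreal (1 / pi) * (\<integral>\<^sup>+w. indicator (cball (0::complex) 1) w \<partial>lborel)"
    by (subst nn_integral_disc_split) auto
  also have "\<dots> = ennreal (1 / pi) * ennreal (pi * 1\<^sup>2)"
    using emeasure_lborel_cball_complex[of 1 0] by simp
  also have "\<dots> = 1" by (subst ennreal_mult[symmetric]) auto
  finally show ?thesis .
qed

lemma prob_\<nu>: "prob_space \<nu>"
  by (rule prob_spaceI) (simp add: emeasure_\<nu>)

lemma prob_on_\<nu>: "prob_on (- U) \<nu>"
proof -
  have "AE z in \<nu>. z \<in> cball 0 1 - U" using AE_\<nu> by eventually_elim auto
  then have "emeasure \<nu> (- (cball 0 1 - U)) = 0"
    by (subst (asm) AE_iff_measurable[OF _ refl]) (auto simp: Compl_eq)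
  then have sub: "msupp \<nu> \<subseteq> cball 0 1 - U"
    using open_U by (intro msupp_subset_closed) auto
  then have "compact (msupp \<nu>)"
    using closed_msupp[OF sets_add_meas] compact_Int_closed[OF compact_cball[of 0 1]]
    by (metis Diff_subset dual_order.trans inf.absorb2)
  then show ?thesis using sub prob_\<nu> by (auto simp: prob_on_def)
qed

text \<open>Off U and B, nu2 has the same potential as the area on U that it replaces, so nu has the
  potential of the full disk. The shifts ln (2L) times mass cancel by
  \<open>mass_\<nu>2\<close>.\<close>

lemma pot_\<nu>:
  assumes L: "L \<ge> 1" and z: "z \<in> cball 0 L - U - B"
  shows "(\<integral>\<^sup>+w. lker (2 * L) z w \<partial>\<nu>) = ennreal (disc_pot L z)"
proof -
  have AE: "AE w in \<nu>2. w \<in> cball 0 L" "AE w in area_meas U. w \<in> cball 0 L"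
    using AE_\<nu>2 AE_area_U L by (auto elim!: eventually_mono)
  let ?p = "\<lambda>\<mu>. \<integral>\<^sup>+w. lker (2 * L) z w \<partial>\<mu>"
  let ?c = "ennreal (ln (2 * L)) * emeasure (area_meas U) UNIV"
  interpret U: finite_measure "area_meas U" by (rule fin_area_U)
  have "?c < \<infinity>"
    using U.emeasure_finite[of UNIV] by (simp add: ennreal_mult_eq_top_iff less_top[symmetric])
  then obtain r where r: "?c = ennreal r" "r \<ge> 0" by (cases ?c) auto
  have "enn2ereal (?p \<nu>2) - ereal r = enn2ereal (?p (area_meas U)) - ereal r"
    using log_pot_\<nu>2[of z] z log_pot_eq[OF sets_\<nu>2 fin_\<nu>2 AE(1) L, of z]
      log_pot_eq[OF sets_area_meas fin_area_U AE(2) L, of z] r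
    by (simp add: mass_\<nu>2 enn2ereal_ennreal)
  then have "enn2ereal (?p \<nu>2) = enn2ereal (?p (area_meas U))"
    by (cases "enn2ereal (?p \<nu>2)"; cases "enn2ereal (?p (area_meas U))") auto
  then have eq: "?p \<nu>2 = ?p (area_meas U)" by (simp add: enn2ereal_inject)
  have "?p \<nu> = ?p \<nu>1 + ?p (area_meas U)"
    by (simp add: nn_integral_add_meas eq)
  also have "\<dots> = ennreal (1 / pi) * (\<integral>\<^sup>+w. lker (2 * L) z w * indicator (cball 0 1) w \<partial>lborel)"
    by (rule nn_integral_disc_split) measurable
  also have "\<dots> = ennreal (1 / pi) * ennreal (pi * disc_pot L z)"
    using L z by (subst disc_potential) (auto simp: disc_pot_def)
  also have "\<dots> = ennreal (disc_pot L z)"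
    using disc_pot_nonneg[of z L] L z by (subst ennreal_mult[symmetric]) auto
  finally show ?thesis .
qed

lemma lenergy_\<nu>_right:
  assumes "L \<ge> 1" "AE z in \<mu>. z \<in> cball 0 L - U - B"
  shows "lenergy (2 * L) \<mu> \<nu> = (\<integral>\<^sup>+z. ennreal (disc_pot L z) \<partial>\<mu>)"
  unfolding lenergy_def
  by (rule nn_integral_cong_AE, use assms(2) in eventually_elim) (use pot_\<nu> assms(1) in auto)

text \<open>The potential formula integrated against mu; the witness is the integral of
  \<open>disc_pot L\<close>. Finiteness of the mutual energy is part of the conclusion, so mu = nu
  yields finite energy of nu.\<close>

lemma lenergy_\<mu>_\<nu>:
  assumes mu: "sets \<mu> = sets borel" "prob_space \<mu>" "AE z in \<mu>. z \<in> cball 0 L - U - B" and L: "L \<ge> 1"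
  obtains p where "lenergy (2 * L) \<mu> \<nu> = ennreal p" "p \<ge> 0" "p \<ge> ln (2 * L) + 1 / 2 - second_moment \<mu> / 2"
    "(AE z in \<mu>. z \<in> cball 0 1) \<Longrightarrow> p = ln (2 * L) + 1 / 2 - second_moment \<mu> / 2"
proof -
  interpret prob_space \<mu> by fact
  note [measurable_cong] = mu(1)
  have AE: "AE z in \<mu>. z \<in> cball 0 L" using mu(3) by eventually_elim auto
  then have nn: "AE z in \<mu>. 0 \<le> disc_pot L z" by eventually_elim (use disc_pot_nonneg L in auto)
  have int: "integrable \<mu> (disc_pot L)"
  proof (rule integrable_const_bound[of _ "ln (2 * L) + 1 / 2"])
    show "AE z in \<mu>. norm (disc_pot L z) \<le> ln (2 * L) + 1 / 2"
      using nn by eventually_elim (use disc_pot_le[OF L] in auto)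
  qed measurable
  note isq = integrable_cmod_sq[OF mu(1) finite_measure_axioms AE]
  let ?q = "\<lambda>z. ln (2 * L) + (1 - (cmod z)\<^sup>2) / 2"
  have intq: "integrable \<mu> ?q" using isq by auto
  have q: "(\<integral>z. ?q z \<partial>\<mu>) = ln (2 * L) + 1 / 2 - second_moment \<mu> / 2"
    using isq by (simp add: second_moment_def prob_space diff_divide_distrib)
  show ?thesis
  proof
    show "lenergy (2 * L) \<mu> \<nu> = ennreal (\<integral>z. disc_pot L z \<partial>\<mu>)"
      using lenergy_\<nu>_right[OF L mu(3)] nn_integral_eq_integral[OF int nn] by simp
    show "(\<integral>z. disc_pot L z \<partial>\<mu>) \<ge> 0" using nn by (rule integral_nonneg_AE)
    show "(\<integral>z. disc_pot L z \<partial>\<mu>) \<ge> ln (2 * L) + 1 / 2 - second_moment \<mu> / 2"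
      unfolding q[symmetric] by (rule integral_mono[OF intq int]) (rule disc_pot_ge[OF L])
    assume "AE z in \<mu>. z \<in> cball 0 1"
    then have "AE z in \<mu>. disc_pot L z = ?q z" by eventually_elim (auto simp: disc_pot_def)
    then show "(\<integral>z. disc_pot L z \<partial>\<mu>) = ln (2 * L) + 1 / 2 - second_moment \<mu> / 2"
      unfolding q[symmetric] by (intro integral_cong_AE) auto
  qed
qed

lemma AE_\<nu>_disc: "AE z in \<nu>. z \<in> cball 0 1" and AE_\<nu>_ball: "L \<ge> 1 \<Longrightarrow> AE z in \<nu>. z \<in> cball 0 L - U - B"
  using AE_\<nu> by (auto elim!: eventually_mono)

lemma lenergy_\<nu>:
  assumes L: "L \<ge> 1"
  shows "lenergy (2 * L) \<nu> \<nu> = ennreal (ln (2 * L) + 1 / 2 - second_moment \<nu> / 2)" "ln (2 * L) + 1 / 2 - second_moment \<nu> / 2 \<ge> 0"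
  using lenergy_\<mu>_\<nu>[OF sets_add_meas prob_\<nu> AE_\<nu>_ball[OF L] L] AE_\<nu>_disc by metis+

text \<open>At L = 1 the shift ln 2 cancels, and the energy absorbs half of the external
  field.\<close>

lemma R_meas_\<nu>: "R_meas \<nu> = ereal (1 / 2 + second_moment \<nu> / 2)"
  using log_energy_eq[OF sets_add_meas prob_\<nu> AE_\<nu>_disc order_refl] lenergy_\<nu>[OF order_refl]
  by (simp add: R_meas_def second_moment_def[symmetric] enn2ereal_ennreal)

text \<open>Write e, p and \<open>?n\<close> for the shifted energies of (mu, mu), (mu, nu) and (nu,
  nu). Dropping the square term of \<open>lenergy_identity\<close> gives 2 p <= e +
  \<open>?n\<close>, and the lower bound on p, from \<open>disc_pot_ge\<close>, turns this into R nu
  <= R mu.\<close>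

lemma R_meas_ge:
  assumes mu: "prob_on (- U) \<mu>"
  shows "R_meas \<nu> \<le> R_meas \<mu>" and "R_meas \<mu> = R_meas \<nu> \<Longrightarrow> \<mu> = \<nu>"
proof -
  have s: "sets \<mu> = sets borel" and "prob_space \<mu>" and sub: "msupp \<mu> \<subseteq> - U" and comp: "compact (msupp \<mu>)"
    using mu by (auto simp: prob_on_def)
  interpret prob_space \<mu> by fact
  note [measurable_cong] = s
  obtain L0 where "msupp \<mu> \<subseteq> cball 0 L0"
    using compact_imp_bounded[OF comp] by (auto simp: bounded_iff subset_iff)
  then have L0: "msupp \<mu> \<subseteq> cball 0 (max 1 L0)" by auto
  \<comment> \<open>One disk has to contain the support of mu and the closed unit disk carrying
    nu.\<close>
  define L where "L = max 1 L0"
  have L: "L \<ge> 1" "L > 0" and suppL: "msupp \<mu> \<subseteq> cball 0 L" using L0 by (auto simp: L_def)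
  have AE: "AE z in \<mu>. z \<in> cball 0 L" using AE_msupp[OF s] by eventually_elim (use suppL in auto)
  have AEnu: "AE z in \<nu>. z \<in> cball 0 L" using AE_\<nu>_ball[OF L(1)] by eventually_elim auto
  note le = log_energy_eq[OF s \<open>prob_space \<mu>\<close> AE L(1)]
  have main: "R_meas \<nu> \<le> R_meas \<mu> \<and> (R_meas \<mu> = R_meas \<nu> \<longrightarrow> \<mu> = \<nu>)"
  proof (cases "lenergy (2 * L) \<mu> \<mu> = \<infinity>")
    case True
    then have "R_meas \<mu> = \<infinity>" by (simp add: le R_meas_def)
    then show ?thesis by (simp add: R_meas_\<nu>)
  next
    case False
    then obtain e where e: "lenergy (2 * L) \<mu> \<mu> = ennreal e" "e \<ge> 0"
      by (cases "lenergy (2 * L) \<mu> \<mu>") auto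
    then have Rmu: "R_meas \<mu> = ereal (e - ln (2 * L) + second_moment \<mu>)"
      by (simp add: le R_meas_def second_moment_def enn2ereal_ennreal)
    \<comment> \<open>Finiteness passes from the shifted energy to the positive part; hence mu does
      not charge B and the mutual energy formula becomes available.\<close>
    have "(\<integral>\<^sup>+z. (\<integral>\<^sup>+w. lkpos z w \<partial>\<mu>) \<partial>\<mu>) \<le> lenergy (2 * L) \<mu> \<mu>"
      unfolding lenergy_def
    proof (rule nn_integral_mono_AE, use AE in eventually_elim)
      case (elim z)
      show ?case
        by (rule nn_integral_mono_AE, use AE in eventually_elim) (use elim L lkpos_le_lker in auto)
    qed
    then have "(\<integral>\<^sup>+z. (\<integral>\<^sup>+w. lkpos z w \<partial>\<mu>) \<partial>\<mu>) < \<infinity>"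
      using e by (auto intro: le_less_trans)
    then have "emeasure \<mu> B = 0"
      by (rule polar_null_finite_energy[OF s finite_measure_axioms _ polar_B])
    then have "AE z in \<mu>. z \<in> - B" by (intro AE_in_of_null_compl s) auto
    with AE AE_msupp[OF s] have AE': "AE z in \<mu>. z \<in> cball 0 L - U - B"
      by eventually_elim (use sub in auto)
    obtain p where p: "lenergy (2 * L) \<mu> \<nu> = ennreal p" "p \<ge> 0" "p \<ge> ln (2 * L) + 1 / 2 - second_moment \<mu> / 2"
      using lenergy_\<mu>_\<nu>[OF s \<open>prob_space \<mu>\<close> AE' L(1)] by metis
    let ?n = "ln (2 * L) + 1 / 2 - second_moment \<nu> / 2"
    note n = lenergy_\<nu>[OF L(1)]
    have "ennreal p + ennreal p \<le> ennreal e + ennreal ?n"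
      using lenergy_identity[OF s \<open>prob_space \<mu>\<close> AE sets_add_meas prob_\<nu> AEnu L(2)] p(1) e(1) n(1)
      by simp
    then have "ennreal (p + p) \<le> ennreal (e + ?n)"
      by (simp only: ennreal_plus p(2) e(2) n(2))
    then have ineq: "p + p \<le> e + ?n" using e n(2) by (subst (asm) ennreal_le_iff) auto
    then have 1: "R_meas \<nu> \<le> R_meas \<mu>"
      using p(3) by (simp add: R_meas_\<nu> Rmu field_simps)
    have "\<mu> = \<nu>" if "R_meas \<mu> = R_meas \<nu>"
    proof (rule lenergy_eq_imp_eq[OF s \<open>prob_space \<mu>\<close> AE sets_add_meas prob_\<nu> AEnu L(2)])
      \<comment> \<open>Equal values of R reverse the inequality, because p is at least its lower
        bound; nothing is left for the square term.\<close>
      have "e + ?n \<le> p + p" using that p(3) by (simp add: R_meas_\<nu> Rmu field_simps)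
      then have "ennreal (e + ?n) \<le> ennreal (p + p)" by (rule ennreal_leI)
      then show "lenergy (2 * L) \<mu> \<mu> + lenergy (2 * L) \<nu> \<nu> \<le> lenergy (2 * L) \<mu> \<nu> + lenergy (2 * L) \<mu> \<nu>"
        by (simp only: ennreal_plus p(1,2) e n)
      show "lenergy (2 * L) \<mu> \<nu> \<noteq> \<infinity>" using p by simp
    qed
    with 1 show ?thesis by simp
  qed
  then show "R_meas \<nu> \<le> R_meas \<mu>" "R_meas \<mu> = R_meas \<nu> \<Longrightarrow> \<mu> = \<nu>" by auto
qed

section \<open>The value of the minimum\<close>

lemma R_set_eq: "R_set U = R_meas \<nu>"
  unfolding R_set_def
  by (rule antisym) (auto intro!: INF_lower INF_greatest prob_on_\<nu> R_meas_ge(1))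

text \<open>nu1 and the area on U make up the normalised disk, whose second moment is (1 / pi) (pi /
  2) = 1/2; nu replaces the share of U by that of nu2.\<close>

lemma second_moment_\<nu>: "second_moment \<nu> = 1 / 2 + ((\<integral> z \<in> frontier U. (cmod z)\<^sup>2 \<partial>\<nu>2) - 1 / pi * (\<integral> z \<in> U. (cmod z)\<^sup>2 \<partial>lborel))"
proof -
  let ?s = "\<lambda>M. \<integral>\<^sup>+z. ennreal ((cmod z)\<^sup>2) \<partial>M"
  let ?JU = "\<integral> z \<in> U. (cmod z)\<^sup>2 \<partial>lborel"
  have AE2: "AE z in \<nu>2. z \<in> cball 0 1" and AE1: "AE z in \<nu>1. z \<in> cball 0 1"
    using AE_\<nu>2 AE_\<nu>1 by (auto elim!: eventually_mono)
  have fin1: "finite_measure \<nu>1" by (rule finite_measure_area_meas) (auto intro: bounded_subset[OF bounded_cball])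
  have nn: "?s M = ennreal (second_moment M)" if "sets M = sets borel" "finite_measure M" "AE z in M. z \<in> cball 0 1" for M
    unfolding second_moment_def by (rule nn_integral_eq_integral[OF integrable_cmod_sq[OF that]]) auto
  have m0: "second_moment M \<ge> 0" for M unfolding second_moment_def by (rule integral_nonneg_AE) auto
  have "ennreal (second_moment \<nu>) = ?s \<nu>"
    using prob_space.finite_measure[OF prob_\<nu>] AE_\<nu>_disc by (intro nn[symmetric]) auto
  also have "\<dots> = ?s \<nu>1 + ?s \<nu>2" by (rule nn_integral_add_meas) auto
  also have "\<dots> = ennreal (second_moment \<nu>1 + second_moment \<nu>2)" using nn[OF _ fin1 AE1] nn[OF _ fin_\<nu>2 AE2] m0 by simp
  finally have 1: "second_moment \<nu> = second_moment \<nu>1 + second_moment \<nu>2"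
    using m0 by (simp add: ennreal_inj del: ennreal_plus)
  have "ennreal (second_moment \<nu>1 + second_moment (area_meas U)) = ?s \<nu>1 + ?s (area_meas U)"
    using nn[OF _ fin1 AE1] nn[OF _ fin_area_U AE_area_U] m0 by simp
  also have "\<dots> = ennreal (1 / pi) * ennreal (pi / 2)"
    using nn_integral_cmod_sq_disc by (subst nn_integral_disc_split) auto
  also have "\<dots> = ennreal (1 / 2)" by (subst ennreal_mult[symmetric]) auto
  finally have 2: "second_moment \<nu>1 + second_moment (area_meas U) = 1 / 2" by (subst (asm) ennreal_inj) (auto simp: m0)
  have 3: "second_moment (area_meas U) = 1 / pi * ?JU"
  proof -
    \<comment> \<open>\<open>integral_density\<close> expects the density as \<open>ennreal\<close>
      of a real function.\<close>
    have "area_meas U = density lborel (\<lambda>w. ennreal (1 / pi * indicator U w))"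
      unfolding area_meas_def by (intro density_cong) (auto split: split_indicator)
    then have "second_moment (area_meas U) = (\<integral>w. (1 / pi * indicator U w) *\<^sub>R (cmod w)\<^sup>2 \<partial>lborel)"
      unfolding second_moment_def by (simp only:) (rule integral_density, auto)
    also have "\<dots> = 1 / pi * ?JU"
      unfolding set_lebesgue_integral_def by (subst integral_mult_right_zero[symmetric]) (simp add: mult.assoc)
    finally show ?thesis .
  qed
  have [measurable]: "frontier U \<in> sets borel" by (simp add: borel_closed)
  have "AE z in \<nu>2. z \<in> frontier U"
    by (rule AE_in_of_null_compl) (auto simp: frontier_\<nu>2)
  then have 4: "(\<integral> z \<in> frontier U. (cmod z)\<^sup>2 \<partial>\<nu>2) = second_moment \<nu>2"
    unfolding second_moment_def set_lebesgue_integral_def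
    by (intro integral_cong_AE) (auto elim!: eventually_mono)
  show ?thesis using 1 2 3 4 by linarith
qed

end

theorem theorem1p3:
  fixes U :: "complex set" and \<nu>2 :: "complex measure"
  assumes "open U" and "U \<subseteq> ball 0 1"
    and "is_balayage U \<nu>2"
  shows "prob_on (- U) (add_meas (area_meas (cball 0 1 - U)) \<nu>2)
    \<and> R_meas (add_meas (area_meas (cball 0 1 - U)) \<nu>2) = R_set U
    \<and> (\<forall>\<mu>. prob_on (- U) \<mu> \<and> R_meas \<mu> = R_set U
            \<longrightarrow> \<mu> = add_meas (area_meas (cball 0 1 - U)) \<nu>2)
    \<and> R_set U = ereal (3/4 + 1/2 * ((\<integral> z \<in> frontier U. (cmod z)\<^sup>2 \<partial>\<nu>2)
                                   - 1/pi * (\<integral> z \<in> U. (cmod z)\<^sup>2 \<partial>lborel)))"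
proof -
  obtain B where B: "polar B" "\<And>z. z \<in> - U - B \<Longrightarrow> log_pot \<nu>2 z = log_pot (area_meas U) z"
    using assms(3) unfolding is_balayage_def qe_on_def by blast
  interpret disc_balayage U \<nu>2 B
  proof (rule disc_balayage.intro)
    show "polar C \<Longrightarrow> emeasure \<nu>2 C = 0" for C
      using assms(3) unfolding is_balayage_def by blast
  qed (use assms B in \<open>simp_all only: is_balayage_def\<close>)
  have arith: "1 / 2 + (1 / 2 + x) / 2 = 3 / 4 + 1 / 2 * x" for x :: real by (simp add: field_simps)
  show ?thesis
  proof (intro conjI allI impI)
    show "prob_on (- U) \<nu>" by (rule prob_on_\<nu>)
    show "R_meas \<nu> = R_set U" by (rule R_set_eq[symmetric])
    show "\<mu> = \<nu>" if "prob_on (- U) \<mu> \<and> R_meas \<mu> = R_set U" for \<mu>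
      using that R_meas_ge(2) by (simp add: R_set_eq)
    show "R_set U = ereal (3/4 + 1/2 * ((\<integral> z \<in> frontier U. (cmod z)\<^sup>2 \<partial>\<nu>2)
                                   - 1/pi * (\<integral> z \<in> U. (cmod z)\<^sup>2 \<partial>lborel)))"
      unfolding R_set_eq R_meas_\<nu> second_moment_\<nu> arith by (rule refl)
  qed
qed

end
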